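(* Let $0<a\le 1/2$. Then the following are equivalent: (i) the real zeros of $Z(s,a)$ are exactly the non-positive even integers $0,-2,-4,\dots$, and each of them is a simple zero; (ii) $1/4\le a\le 1/2$.
   Context: For $0<a\le 1$ the Hurwitz zeta function is $\zeta(s,a)=\sum_{n=0}^\infty (n+a)^{-s}$ for $\Re(s)>1$, continued meromorphically to $\mathbb{C}$ with a single simple pole at $s=1$. For $0<a\le 1/2$ define $Z(s,a)=\zeta(s,a)+\zeta(s,1-a)$ (meromorphic in $s$ with a pole at $s=1$). *)

theory Defs
  imports "HOL-Complex_Analysis.Complex_Analysis"
begin

lemma nicely_meromorphic_continuation_unique:
  assumes f: "f nicely_meromorphic_on UNIV" and g: "g nicely_meromorphic_on UNIV"
    and eq: "\<And>s. Re s > c \<Longrightarrow> f s = g s"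
  shows "f = g"
proof
  fix z
  have mero: "f meromorphic_on UNIV" "g meromorphic_on UNIV"
    using f g by (auto simp: nicely_meromorphic_on_def)
  define h where "h = (\<lambda>s. f s - g s)"
  have h: "h meromorphic_on UNIV"
    unfolding h_def by (intro meromorphic_intros mero)
  let ?p = "complex_of_real (c + 1)"
  have "eventually (\<lambda>s. Re s > c) (nhds ?p)"
    by (intro eventually_nhds_in_open[of "{s. Re s > c}", simplified] open_halfspace_Re_gt) auto
  hence "eventually (\<lambda>s. h s = 0) (at ?p)"
    unfolding eventually_at_filter by eventually_elim (simp add: h_def eq)
  hence "\<not> eventually (\<lambda>s. h s \<noteq> 0) (at ?p)"
    using eventually_conj[of "\<lambda>s. h s = 0" "at ?p" "\<lambda>s. h s \<noteq> 0"] by auto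
  hence "\<not> eventually (\<lambda>s. h s \<noteq> 0) (cosparse UNIV)"
    by (auto simp: eventually_cosparse_open_eq)
  hence "eventually (\<lambda>s. h s = 0) (cosparse UNIV)"
    using meromorphic_imp_constant_or_avoid[OF h, of 0] by auto
  hence "eventually (\<lambda>s. h s = 0) (at z)"
    by (simp add: eventually_cosparse_open_eq)
  hence ev: "eventually (\<lambda>s. f s = g s) (at z)"
    by (simp add: h_def)
  have pole: "is_pole f z \<longleftrightarrow> is_pole g z"
    by (rule is_pole_cong[OF ev refl])
  show "f z = g z"
  proof (cases "is_pole f z")
    case True
    have "f z = 0" "g z = 0"
      using f g True pole is_pole_def not_tendsto_and_filterlim_at_infinity[of "at z"]
      unfolding nicely_meromorphic_on_def by (metis UNIV_I at_neq_bot)+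
    thus ?thesis by simp
  next
    case False
    have "f \<midarrow>z\<rightarrow> f z" "g \<midarrow>z\<rightarrow> g z"
      using f g False pole unfolding nicely_meromorphic_on_def by auto
    moreover from this(2) have "f \<midarrow>z\<rightarrow> g z"
      using tendsto_cong[OF ev] by blast
    ultimately show ?thesis using LIM_unique by blast
  qed
qed

text \<open>
  The continuation is unique by the preceding lemma: \<^const>\<open>nicely_meromorphic_on\<close> fixes
  the value at a pole to be 0; hence the junk value \<open>hurwitz_zeta a 1 = 0\<close>. Only
  \<open>0 < a \<le> 1\<close> is intended.
\<close>

definition hurwitz_zeta :: "real \<Rightarrow> complex \<Rightarrow> complex" where
  "hurwitz_zeta a = (THE f. f nicely_meromorphic_on UNIV \<and>
     (\<forall>s. Re s > 1 \<longrightarrow> (\<lambda>n. complex_of_real (real n + a) powr (- s)) sums f s))"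

definition hurwitz_Z :: "real \<Rightarrow> complex \<Rightarrow> complex" where
  "hurwitz_Z a s = hurwitz_zeta a s + hurwitz_zeta (1 - a) s"

text \<open>The pole \<open>s = 1\<close>, where the junk value of \<^const>\<open>hurwitz_Z\<close> is 0, is not a zero.\<close>

definition real_zeros_Z :: "real \<Rightarrow> real set" where
  "real_zeros_Z a = {x. x \<noteq> 1 \<and> hurwitz_Z a (complex_of_real x) = 0}"

end

theory Submission
  imports Defs
begin

text \<open>
  Let \<open>K(y) = (\<pi> / sin (\<pi> (a + i y)))\<^sup>2\<close>. By the partial fraction expansion (the reflection formula of
  the trigamma function) \<open>K(y)\<close> is the sum over \<open>n \<ge> 0\<close> of
  \<open>1 / (n + a + i y)\<^sup>2 + 1 / (n + 1 - a - i y)\<^sup>2\<close>. Multiplying by \<open>y powr (1 - s)\<close> and integrating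
  termwise, for real \<open>1 < s < 2\<close>, turns every summand into a Beta integral and yields
  \<open>\<kappa> \<zeta>(s, a) + cnj \<kappa> \<zeta>(s, 1 - a)\<close> with
  \<open>\<kappa> = (s - 1) \<pi> / 2 (1 / sin (\<pi> s / 2) + i / cos (\<pi> s / 2))\<close>. Since \<open>K\<close> decays exponentially, the integral
  is holomorphic for \<open>Re s < 2\<close>. Its real and imaginary parts give the continuation of \<open>\<zeta>(s, a)\<close>, and
  the real part gives
  \<open>Z(s, a) = 2 sin (\<pi> s / 2) / (\<pi> (s - 1)) \<cdot> M(s)\<close> where \<open>M(s)\<close> is the integral of
  \<open>y powr (1 - s) * Re K(y)\<close>. With \<open>c = cos (2 \<pi> a)\<close>, the sign of \<open>Re K(y)\<close> is that of
  \<open>1 - c cosh (2 \<pi> y)\<close>. If \<open>c \<le> 0\<close> then \<open>M > 0\<close>, so for \<open>s < 1\<close> only the zeros of the sine remain. If \<open>c > 0\<close>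
  then \<open>M(1) > 0\<close> but \<open>M(s) < 0\<close> for some \<open>s < 1\<close>, so \<open>M\<close> has a zero on the real axis left of 1, which
  is either an additional zero of \<open>Z\<close> or makes one of the trivial zeros multiple.
\<close>

subsection \<open>The integrals of the partial fractions\<close>

text \<open>The substitution \<open>t = y^2 / (b^2 + y^2)\<close>, with
  \<open>1 - t = b^2 / (b^2 + y^2)\<close>, maps the half-line bijectively onto the unit interval
  and produces the Beta integrand \<open>t powr (p - 1) * (1 - t) powr (q - 1)\<close>.\<close>

lemma has_integral_Beta_half_line:
  fixes b p q :: real
  assumes b: "b > 0" and p: "p > 0" and q: "q > 0"
  shows "((\<lambda>y. y powr (2 * p - 1) / (b\<^sup>2 + y\<^sup>2) powr (p + q))
           has_integral (Beta p q / 2 * b powr (- 2 * q))) {0<..}"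
proof -
  define g where "g = (\<lambda>y::real. y\<^sup>2 / (b\<^sup>2 + y\<^sup>2))"
  define g' where "g' = (\<lambda>y::real. 2 * y * b\<^sup>2 / (b\<^sup>2 + y\<^sup>2)\<^sup>2)"
  define f where "f = (\<lambda>t::real. t powr (p - 1) * (1 - t) powr (q - 1))"
  have pos: "b\<^sup>2 + y\<^sup>2 > 0" for y :: real
    using b by (simp add: add_pos_nonneg)
  have nz: "b\<^sup>2 + y\<^sup>2 \<noteq> 0" for y :: real
    using pos[of y] by linarith
  have der: "(g has_field_derivative g' y) (at y within {0<..})" for y
    unfolding g_def g'_def using nz[of y]
    by (auto intro!: derivative_eq_intros simp: power2_eq_square field_simps)
  have eq1: "1 - g y = b\<^sup>2 / (b\<^sup>2 + y\<^sup>2)" for y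
    using nz[of y] by (simp add: g_def field_simps)
  have inj: "inj_on g {0<..}"
  proof (rule inj_onI)
    fix x y assume xy: "x \<in> {0<..}" "y \<in> {0<..}" "g x = g y"
    hence "b\<^sup>2 / (b\<^sup>2 + x\<^sup>2) = b\<^sup>2 / (b\<^sup>2 + y\<^sup>2)" using eq1 by metis
    hence "x\<^sup>2 = y\<^sup>2" using b nz by (simp add: field_simps)
    thus "x = y" using xy by (simp add: power2_eq_iff_nonneg)
  qed
  have img: "g ` {0<..} = {0<..<1}"
  proof (intro equalityI subsetI)
    fix t assume "t \<in> g ` {0<..}"
    then obtain y where y: "y > 0" "t = g y" by auto
    show "t \<in> {0<..<1}" using y b pos[of y] unfolding y(2) g_def by simp
  next
    fix t :: real assume t: "t \<in> {0<..<1}"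
    define y where "y = b * sqrt (t / (1 - t))"
    have "y\<^sup>2 = b\<^sup>2 * (t / (1 - t))" using t by (simp add: y_def power_mult_distrib)
    moreover from this have "b\<^sup>2 + y\<^sup>2 = b\<^sup>2 / (1 - t)" using t by (simp add: field_simps)
    ultimately have "g y = t" using t b by (simp add: g_def)
    moreover have "y > 0" using t b by (simp add: y_def)
    ultimately show "t \<in> g ` {0<..}" by force
  qed
  have "(f has_integral Beta p q) {0<..<1}"
    using has_integral_Beta_real[OF p q] by (simp add: f_def has_integral_Icc_iff_Ioo)
  moreover from this have "f absolutely_integrable_on {0<..<1}"
    by (intro nonnegative_absolutely_integrable_1) (auto simp: f_def)
  ultimately have "(\<lambda>x. \<bar>g' x\<bar> * f (g x)) absolutely_integrable_on {0<..} \<and>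
      integral {0<..} (\<lambda>x. \<bar>g' x\<bar> * f (g x)) = Beta p q"
    by (subst has_absolute_integral_change_of_variables_1'[OF _ der inj])
      (auto simp: img integral_unique)
  hence "((\<lambda>x. \<bar>g' x\<bar> * f (g x)) has_integral Beta p q) {0<..}"
    by (metis set_lebesgue_integral_eq_integral(1) integrable_integral)
  from has_integral_mult_right[OF this, of "b powr (- 2 * q) / 2"]
  have "((\<lambda>x. b powr (- 2 * q) / 2 * (\<bar>g' x\<bar> * f (g x))) has_integral
      (Beta p q / 2 * b powr (- 2 * q))) {0<..}" by (simp add: mult_ac)
  thus ?thesis
  proof (rule has_integral_eq[rotated])
    fix y :: real assume "y \<in> {0<..}"
    hence y: "y > 0" by simp
    have sq: "y\<^sup>2 = y powr 2" "b\<^sup>2 = b powr 2"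
      using y b by simp_all
    define W where "W = b\<^sup>2 + y\<^sup>2"
    have W: "W > 0" using pos by (simp add: W_def)
    have "f (g y) = (y powr 2 / W) powr (p - 1) * (b powr 2 / W) powr (q - 1)"
      unfolding f_def eq1 unfolding g_def W_def sq ..
    also have "\<dots> = y powr (2 * p - 2) * b powr (2 * q - 2) * W powr (2 - p - q)"
    proof -
      have "(y powr 2 / W) powr (p - 1) = y powr (2 * p - 2) * W powr (1 - p)"
        using y W powr_minus_divide[of W "p - 1"]
        by (simp add: powr_divide powr_powr algebra_simps del: powr_numeral)
      moreover have "(b powr 2 / W) powr (q - 1) = b powr (2 * q - 2) * W powr (1 - q)"
        using b W powr_minus_divide[of W "q - 1"]
        by (simp add: powr_divide powr_powr algebra_simps del: powr_numeral)
      moreover have "W powr (1 - p) * W powr (1 - q) = W powr (2 - p - q)"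
        by (simp add: powr_add[symmetric] algebra_simps)
      ultimately show ?thesis by simp
    qed
    finally have f: "f (g y) = y powr (2 * p - 2) * b powr (2 * q - 2) * W powr (2 - p - q)" .
    have "\<bar>g' y\<bar> = 2 * y powr 1 * b powr 2 * W powr (-2)"
      using y b W unfolding g'_def W_def[symmetric] by (simp add: powr_minus_divide)
    hence "b powr (- 2 * q) / 2 * (\<bar>g' y\<bar> * f (g y)) =
        (b powr (- 2 * q) * b powr 2 * b powr (2 * q - 2)) * (y powr 1 * y powr (2 * p - 2)) *
        (W powr (-2) * W powr (2 - p - q))"
      unfolding f by (simp add: mult_ac)
    also have "\<dots> = y powr (2 * p - 1) * W powr (- (p + q))"
      unfolding powr_add[symmetric] using b by (simp add: algebra_simps)
    also have "\<dots> = y powr (2 * p - 1) / W powr (p + q)" unfolding powr_minus divide_inverse ..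
    finally show "b powr (- 2 * q) / 2 * (\<bar>g' y\<bar> * f (g y)) =
      y powr (2 * p - 1) / (b\<^sup>2 + y\<^sup>2) powr (p + q)" by (simp add: W_def)
  qed
qed

text \<open>For \<open>1 < s < 2\<close> this is the integral of
  \<open>y powr (1 - s) / (1 + i y)^2\<close> over the positive half-line; replacing
  \<open>1 + i y\<close> by \<open>b + i y\<close> only contributes the factor
  \<open>b powr (- s)\<close>.\<close>

definition mellin_kappa :: "real \<Rightarrow> complex" where
  "mellin_kappa s = Complex ((s - 1) * pi / (2 * sin (pi * s / 2)))
                            ((s - 1) * pi / (2 * cos (pi * s / 2)))"

text \<open>The integrand is the modulus of \<open>y powr (1 - s) / (b + i y)^2\<close>; its
  integral controls the majorant in the termwise integration.\<close>

lemma has_integral_powr_over_sum_squares: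
  fixes b s :: real
  assumes "b > 0" "0 < s" "s < 2"
  shows "((\<lambda>y. y powr (1 - s) / (b\<^sup>2 + y\<^sup>2)) has_integral
            (Beta (1 - s/2) (s/2) / 2 * b powr (- s))) {0<..}"
  using has_integral_Beta_half_line[of b "1 - s/2" "s/2"] assms
  by (simp add: algebra_simps add_nonneg_nonneg)

text \<open>Since \<open>1 / (b + i y)^2 = (b^2 - y^2 - 2 i b y) / (b^2 + y^2)^2\<close>, the
  integral splits into three real Beta integrals, which the reflection formula of Gamma turns into
  sines and cosines.\<close>

lemma has_integral_powr_over_square:
  fixes b s :: real
  assumes b: "b > 0" and s: "1 < s" "s < 2"
  shows "((\<lambda>y. of_real (y powr (1 - s)) / (Complex b y)\<^sup>2) has_integral
            (of_real (b powr (- s)) * mellin_kappa s)) {0<..}"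
proof -
  have pos: "b\<^sup>2 + y\<^sup>2 > 0" for y :: real
    using b by (simp add: add_pos_nonneg)
  have reflection: "Gamma x * Gamma (1 - x) = pi / sin (pi * x)" for x :: real
  proof -
    have "complex_of_real (Gamma x * Gamma (1 - x)) = of_real (pi / sin (pi * x))"
      using Gamma_reflection_complex[of "of_real x"]
      by (simp add: Gamma_complex_of_real[symmetric] sin_of_real[symmetric])
    thus ?thesis by (simp only: of_real_eq_iff)
  qed
  have G2: "Gamma (2::real) = 1" using Gamma_numeral[of "num.Bit0 num.One"] by simp
  have G: "Gamma (x + 1) = x * Gamma x" if "x > 0" for x :: real
    using that by (intro Gamma_plus1) (auto elim!: nonpos_Ints_cases)
  have sc: "sin (pi * (1 - s/2)) = sin (pi * s / 2)" "sin (pi * ((s - 1)/2)) = - cos (pi * s / 2)"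
           "sin (pi * (s/2)) = sin (pi * s / 2)" 
    by (simp_all add: algebra_simps sin_diff diff_divide_distrib add_divide_distrib)
  \<comment> \<open>\<open>B1\<close>, \<open>B2\<close>, \<open>B3\<close> belong to the weights
    \<open>y powr (1 - s)\<close>, \<open>y powr (3 - s)\<close>, \<open>y powr (2 - s)\<close>. The
    arguments always add up to 2, so the denominator of Beta is \<open>Gamma 2 = 1\<close>.\<close>
  define B1 where "B1 = Beta (1 - s/2) (1 + s/2)"
  define B2 where "B2 = Beta (2 - s/2) (s/2)"
  define B3 where "B3 = Beta ((3 - s)/2) ((1 + s)/2)"
  have "B1 = Gamma (1 - s/2) * Gamma (s/2 + 1)" by (simp add: B1_def Beta_def G2 add.commute)
  also have "\<dots> = s / 2 * (pi / sin (pi * s / 2))"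
    using s by (subst G) (simp_all add: reflection[of "s/2", unfolded sc, symmetric] mult_ac)
  finally have B1: "B1 = s / 2 * (pi / sin (pi * s / 2))" .
  have "B2 = Gamma ((1 - s/2) + 1) * Gamma (s/2)" by (simp add: B2_def Beta_def G2)
  also have "\<dots> = (1 - s / 2) * (pi / sin (pi * s / 2))"
    using s by (subst G) (simp_all add: reflection[of "s/2", unfolded sc, symmetric] mult_ac)
  finally have B2: "B2 = (1 - s / 2) * (pi / sin (pi * s / 2))" .
  have "B3 = Gamma ((3 - s)/2) * Gamma ((s - 1)/2 + 1)"
    by (simp add: B3_def Beta_def G2 add_divide_distrib diff_divide_distrib)
  also have "\<dots> = (s - 1) / 2 * (Gamma ((s - 1)/2) * Gamma (1 - (s - 1)/2))"
    using s by (subst G) (simp_all add: diff_divide_distrib mult_ac)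
  also have "\<dots> = - (s - 1) / 2 * (pi / cos (pi * s / 2))"
    unfolding reflection sc by (cases "cos (pi * s / 2) = 0") (simp_all add: field_simps)
  finally have B3: "B3 = - (s - 1) / 2 * (pi / cos (pi * s / 2))" .
  have kappa: "mellin_kappa s = Complex ((B1 - B2) / 2) (- B3)"
    by (cases "sin (pi * s / 2) = 0"; cases "cos (pi * s / 2) = 0")
      (simp_all add: mellin_kappa_def B1 B2 B3 complex_eq_iff field_simps)
  \<comment> \<open>Together with the powers of \<open>b\<close> in the numerator, all three terms
    scale in the same way.\<close>
  have bb: "b powr (- 2 * (1 + s/2)) * b\<^sup>2 = b powr (- s)"
           "b powr (- 2 * (s/2)) = b powr (- s)"
           "b powr (- 2 * ((1 + s)/2)) * b = b powr (- s)"
  proof -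
    have *: "- 2 * (1 + s/2) = - 2 - s" "- 2 * ((1 + s)/2) = - 1 - s" "- 2 * (s/2) = - s"
      by (auto simp: field_simps)
    thus "b powr (- 2 * (1 + s/2)) * b\<^sup>2 = b powr (- s)" "b powr (- 2 * (s/2)) = b powr (- s)"
      "b powr (- 2 * ((1 + s)/2)) * b = b powr (- s)"
      unfolding * using b powr_add[of b "- 2 - s" 2] powr_add[of b "- 1 - s" 1] by simp_all
  qed
  have i1: "((\<lambda>y. y powr (1 - s) / (b\<^sup>2 + y\<^sup>2)\<^sup>2) has_integral (B1 / 2 * b powr (- 2 * (1 + s/2)))) {0<..}"
    using has_integral_Beta_half_line[of b "1 - s/2" "1 + s/2"] b s pos
    by (simp add: B1_def powr_numeral)
  have i2: "((\<lambda>y. y powr (3 - s) / (b\<^sup>2 + y\<^sup>2)\<^sup>2) has_integral (B2 / 2 * b powr (- 2 * (s/2)))) {0<..}"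
    using has_integral_Beta_half_line[of b "2 - s/2" "s/2"] b s pos
    by (simp add: B2_def powr_numeral)
  have i3: "((\<lambda>y. y powr (2 - s) / (b\<^sup>2 + y\<^sup>2)\<^sup>2) has_integral (B3 / 2 * b powr (- 2 * ((1 + s)/2)))) {0<..}"
  proof -
    have *: "2 * ((3 - s)/2) - 1 = 2 - s" "(3 - s)/2 + (1 + s)/2 = 2" by (auto simp: field_simps)
    show ?thesis
      using has_integral_Beta_half_line[of b "(3 - s)/2" "(1 + s)/2", unfolded *] b s pos
      by (simp add: B3_def)
  qed
  have re: "((\<lambda>y. b\<^sup>2 * (y powr (1 - s) / (b\<^sup>2 + y\<^sup>2)\<^sup>2) - y powr (3 - s) / (b\<^sup>2 + y\<^sup>2)\<^sup>2)
      has_integral (b powr (- s) * ((B1 - B2) / 2))) {0<..}"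
    using has_integral_diff[OF has_integral_mult_right[OF i1, of "b\<^sup>2"] i2] 
    unfolding bb(2) bb(1)[symmetric] by (simp add: algebra_simps diff_divide_distrib)
  have im: "((\<lambda>y. - 2 * b * (y powr (2 - s) / (b\<^sup>2 + y\<^sup>2)\<^sup>2))
      has_integral (b powr (- s) * (- B3))) {0<..}"
    using has_integral_mult_right[OF i3, of "- 2 * b"] 
    unfolding bb(3)[symmetric] by (simp add: algebra_simps)
  have "((\<lambda>y. of_real (b\<^sup>2 * (y powr (1 - s) / (b\<^sup>2 + y\<^sup>2)\<^sup>2) - y powr (3 - s) / (b\<^sup>2 + y\<^sup>2)\<^sup>2)
       + \<i> * of_real (- 2 * b * (y powr (2 - s) / (b\<^sup>2 + y\<^sup>2)\<^sup>2))) has_integral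
       (of_real (b powr (- s) * ((B1 - B2) / 2)) + \<i> * of_real (b powr (- s) * (- B3)))) {0<..}"
    by (intro has_integral_add has_integral_mult_right has_integral_of_real re im)
  also have "of_real (b powr (- s) * ((B1 - B2) / 2)) + \<i> * of_real (b powr (- s) * (- B3)) =
      of_real (b powr (- s)) * mellin_kappa s"
    by (simp add: kappa complex_eq_iff)
  finally show ?thesis
  proof (rule has_integral_eq[rotated])
    fix y :: real assume "y \<in> {0<..}"
    hence y: "y > 0" by simp
    have p3: "y powr (3 - s) = y\<^sup>2 * y powr (1 - s)" "y powr (2 - s) = y * y powr (1 - s)"
      using y powr_add[of y 2 "1 - s"] powr_add[of y 1 "1 - s"] by (simp_all add: powr_numeral)
    have n: "Complex b y \<noteq> 0" using b by (simp add: complex_eq_iff)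
    have "1 / (Complex b y)\<^sup>2 = (Complex b (- y))\<^sup>2 / (of_real (b\<^sup>2 + y\<^sup>2))\<^sup>2"
    proof -
      have e: "complex_of_real (b\<^sup>2 + y\<^sup>2) = Complex b y * Complex b (- y)"
        by (simp add: complex_eq_iff power2_eq_square)
      have n': "Complex b (-y) \<noteq> 0" using b by (simp add: complex_eq_iff)
      show ?thesis unfolding e using n n' by (simp add: power_mult_distrib)
    qed
    also have "(Complex b (- y))\<^sup>2 = of_real (b\<^sup>2 - y\<^sup>2) + \<i> * of_real (- 2 * b * y)"
      by (simp add: complex_eq_iff power2_eq_square)
    finally have e: "1 / (Complex b y)\<^sup>2 =
      (of_real (b\<^sup>2 - y\<^sup>2) + \<i> * of_real (- 2 * b * y)) / (of_real (b\<^sup>2 + y\<^sup>2))\<^sup>2" .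
    have "of_real (y powr (1 - s)) / (Complex b y)\<^sup>2 = of_real (y powr (1 - s)) * (1 / (Complex b y)\<^sup>2)"
      by simp
    thus "of_real (b\<^sup>2 * (y powr (1 - s) / (b\<^sup>2 + y\<^sup>2)\<^sup>2) - y powr (3 - s) / (b\<^sup>2 + y\<^sup>2)\<^sup>2)
       + \<i> * of_real (- 2 * b * (y powr (2 - s) / (b\<^sup>2 + y\<^sup>2)\<^sup>2)) = of_real (y powr (1 - s)) / (Complex b y)\<^sup>2"
      unfolding e p3 by (simp add: add_divide_distrib diff_divide_distrib algebra_simps)
  qed
qed

subsection \<open>The kernel\<close>

lemma one_minus_notin_Ints:
  fixes z :: "'a :: ring_1"
  assumes "z \<notin> \<int>"
  shows "1 - z \<notin> \<int>"
proof
  assume "1 - z \<in> \<int>"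
  from Ints_diff[OF Ints_1 this] assms show False by simp
qed

text \<open>This is the logarithmic derivative of
  \<open>Gamma z * Gamma (1 - z) = pi / sin (pi z)\<close>: both sides are differentiated and the
  common nonzero factor \<open>pi / sin (pi z)\<close> is cancelled.\<close>

lemma Digamma_reflection_complex:
  fixes z :: complex
  assumes z: "z \<notin> \<int>"
  shows "Digamma (1 - z) - Digamma z = of_real pi * cot (of_real pi * z)"
proof -
  have nz: "z \<notin> \<int>\<^sub>\<le>\<^sub>0" "1 - z \<notin> \<int>\<^sub>\<le>\<^sub>0"
    using z one_minus_notin_Ints[OF z] nonpos_Ints_subset_Ints by blast+
  have s: "sin (of_real pi * z) \<noteq> 0"
    using z by (auto simp: sin_eq_0)
  have "((\<lambda>w. Gamma w * Gamma (1 - w)) has_field_derivative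
      Gamma z * Gamma (1 - z) * (Digamma z - Digamma (1 - z))) (at z)"
    using nz by (auto intro!: derivative_eq_intros simp: algebra_simps)
  moreover have "((\<lambda>w. Gamma w * Gamma (1 - w)) has_field_derivative
      - of_real pi * (of_real pi * cos (of_real pi * z)) / (sin (of_real pi * z))\<^sup>2) (at z)"
    unfolding Gamma_reflection_complex using s
    by (auto intro!: derivative_eq_intros simp: power2_eq_square)
  ultimately have "Gamma z * Gamma (1 - z) * (Digamma z - Digamma (1 - z)) =
      - of_real pi * (of_real pi * cos (of_real pi * z)) / (sin (of_real pi * z))\<^sup>2"
    by (rule DERIV_unique)
  moreover have "Gamma z * Gamma (1 - z) * (Digamma (1 - z) - Digamma z) =
      - (Gamma z * Gamma (1 - z) * (Digamma z - Digamma (1 - z)))"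
    by (simp add: right_diff_distrib)
  ultimately have *: "(of_real pi / sin (of_real pi * z)) * (Digamma (1 - z) - Digamma z) =
      (of_real pi / sin (of_real pi * z)) * (of_real pi * cot (of_real pi * z))"
    unfolding Gamma_reflection_complex cot_def by (simp add: power2_eq_square)
  have "of_real pi / sin (of_real pi * z) \<noteq> 0" using s by simp
  from mult_left_cancel[OF this] * show ?thesis by (rule iffD1)
qed

text \<open>Differentiating the reflection formula of Digamma once more suffices, as that formula
  holds on the open complement of the integers.\<close>

lemma Trigamma_reflection_complex:
  fixes z :: complex
  assumes z: "z \<notin> \<int>"
  shows "Polygamma 1 z + Polygamma 1 (1 - z) = (of_real pi / sin (of_real pi * z))\<^sup>2"
proof -
  have nz: "z \<notin> \<int>\<^sub>\<le>\<^sub>0" "1 - z \<notin> \<int>\<^sub>\<le>\<^sub>0"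
    using z one_minus_notin_Ints[OF z] nonpos_Ints_subset_Ints by blast+
  have s: "sin (of_real pi * z) \<noteq> 0"
    using z by (auto simp: sin_eq_0)
  have d1: "((\<lambda>w. Digamma (1 - w) - Digamma w) has_field_derivative
      - Polygamma 1 (1 - z) - Polygamma 1 z) (at z)"
    using nz by (auto intro!: derivative_eq_intros)
  have "((\<lambda>w. of_real pi * cot (of_real pi * w)) has_field_derivative
      of_real pi * (- inverse ((sin (of_real pi * z))\<^sup>2) * (of_real pi * 1))) (at z)"
    by (intro DERIV_cmult DERIV_chain2[of cot] DERIV_cot s DERIV_ident)
  also have "of_real pi * (- inverse ((sin (of_real pi * z))\<^sup>2) * (of_real pi * 1)) =
      - (of_real pi / sin (of_real pi * z))\<^sup>2"
    by (simp add: power2_eq_square divide_inverse)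
  finally have "((\<lambda>w. Digamma (1 - w) - Digamma w) has_field_derivative
      - (of_real pi / sin (of_real pi * z))\<^sup>2) (at z)"
    by (rule has_field_derivative_transform_within_open[of _ _ _ "- \<int>"])
      (use z in \<open>simp_all add: Digamma_reflection_complex open_Compl\<close>)
  from DERIV_unique[OF d1 this]
  have "- (Polygamma 1 z + Polygamma 1 (1 - z)) = - (of_real pi / sin (of_real pi * z))\<^sup>2"
    by (simp only: minus_add_distrib diff_conv_add_uminus add.commute)
  thus ?thesis by (simp only: neg_equal_iff_equal)
qed

text \<open>The two families of summands are the series of the trigamma function at \<open>z\<close>
  and at \<open>1 - z\<close>.\<close>

lemma csc_squared_sums:
  fixes z :: complex
  assumes z: "z \<notin> \<int>"
  shows "(\<lambda>n. 1 / (z + of_nat n)\<^sup>2 + 1 / (1 - z + of_nat n)\<^sup>2) sums (of_real pi / sin (of_real pi * z))\<^sup>2"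
proof -
  have sm: "(\<lambda>n. 1 / (w + of_nat n)\<^sup>2) sums Polygamma 1 w" if "w \<notin> \<int>" for w :: complex
  proof -
    have "w \<noteq> 0" using that by auto
    hence "summable (\<lambda>n. inverse ((w + of_nat n)\<^sup>2))"
      by (intro Polygamma_converges') auto
    thus ?thesis
      by (simp add: Polygamma_def sums_iff divide_inverse numeral_2_eq_2)
  qed
  from sums_add[OF sm[OF z] sm[OF one_minus_notin_Ints[OF z]]] show ?thesis
    by (simp only: Trigamma_reflection_complex[OF z])
qed

section \<open>The kernel on a vertical line: expansion, symmetry, closed form and decay\<close>

definition csc_kernel :: "real \<Rightarrow> real \<Rightarrow> complex" where
  "csc_kernel a y = (of_real pi / sin (of_real pi * Complex a y))\<^sup>2"

lemma Complex_notin_Ints: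
  assumes "0 < a" "a < 1"
  shows "Complex a y \<notin> \<int>"
proof
  assume "Complex a y \<in> \<int>"
  then obtain k :: int where "Complex a y = of_int k" by (rule Ints_cases)
  hence "a = of_int k" by (simp add: complex_eq_iff)
  with assms show False by simp
qed

text \<open>The terms with \<open>1 - z\<close> are written as conjugates, because
  \<open>n + 1 - (a + i y)\<close> is the conjugate of \<open>n + (1 - a) + i y\<close>. One
  integral formula then serves both families.\<close>

lemma csc_kernel_sums:
  assumes a: "0 < a" "a < 1"
  shows "(\<lambda>n. 1 / (Complex (real n + a) y)\<^sup>2 + cnj (1 / (Complex (real n + (1 - a)) y)\<^sup>2))
           sums csc_kernel a y"
proof -
  have "Complex a y + of_nat n = Complex (real n + a) y"
    "1 - Complex a y + of_nat n = cnj (Complex (real n + (1 - a)) y)" for n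
    by (simp_all add: complex_eq_iff)
  with csc_squared_sums[OF Complex_notin_Ints[OF a, of y]] show ?thesis
    by (simp add: csc_kernel_def)
qed

text \<open>From \<open>sin (pi - w) = sin w\<close> and the fact that \<open>1 - a + i y\<close> is
  1 minus the conjugate of \<open>a + i y\<close>. Because of this symmetry only the real part of
  the kernel survives in \<open>hurwitz_Z\<close>.\<close>

lemma csc_kernel_reflect: "csc_kernel (1 - a) y = cnj (csc_kernel a y)"
proof -
  have "of_real pi * Complex (1 - a) y = of_real pi - cnj (of_real pi * Complex a y)"
    by (simp add: complex_eq_iff right_diff_distrib)
  moreover have "sin (complex_of_real pi) = 0" "cos (complex_of_real pi) = - 1"
    by (metis sin_of_real sin_pi of_real_0) (metis cos_of_real cos_pi of_real_1 of_real_minus)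
  ultimately have "sin (of_real pi * Complex (1 - a) y) = cnj (sin (of_real pi * Complex a y))"
    unfolding cnj_sin by (simp only: sin_diff) simp
  thus ?thesis by (simp add: csc_kernel_def)
qed

lemma continuous_on_csc_kernel:
  assumes "0 < a" "a < 1"
  shows "continuous_on A (csc_kernel a)"
proof -
  have "sin (of_real pi * Complex a y) \<noteq> 0" for y
    using Complex_notin_Ints[OF assms, of y] by (auto simp: sin_eq_0)
  thus ?thesis unfolding csc_kernel_def by (intro continuous_intros) auto
qed

text \<open>The double angle formula \<open>2 sin^2 w = 1 - cos (2 w)\<close>, with the cosine split
  into real and imaginary part, brings the denominator into Cartesian form.\<close>

lemma csc_kernel_altdef:
  "csc_kernel a y = of_real (2 * pi\<^sup>2) /
     Complex (1 - cos (2 * pi * a) * cosh (2 * pi * y)) (sin (2 * pi * a) * sinh (2 * pi * y))"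
proof -
  have "2 * (sin (of_real pi * Complex a y))\<^sup>2 = 1 - cos (2 * (of_real pi * Complex a y))"
    by (subst cos_double_sin) simp
  also have "\<dots> = Complex (1 - cos (2 * pi * a) * cosh (2 * pi * y)) (sin (2 * pi * a) * sinh (2 * pi * y))"
    by (simp add: complex_eq_iff Re_cos Im_cos cosh_def sinh_def field_simps)
  finally have "Complex (1 - cos (2 * pi * a) * cosh (2 * pi * y)) (sin (2 * pi * a) * sinh (2 * pi * y)) =
     2 * (sin (of_real pi * Complex a y))\<^sup>2" ..
  thus ?thesis unfolding csc_kernel_def by (simp add: power_divide)
qed

text \<open>The squared modulus of the denominator of the kernel is a perfect square, which gives
  both \<open>Re (csc_kernel a y)\<close> and the norm in closed form.\<close>

lemma csc_kernel_denominator: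
  fixes u v :: real
  shows "(1 - cos u * cosh v)\<^sup>2 + (sin u * sinh v)\<^sup>2 = (cosh v - cos u)\<^sup>2"
proof -
  have "(sin u * sinh v)\<^sup>2 = (1 - (cos u)\<^sup>2) * ((cosh v)\<^sup>2 - 1)"
    using sin_squared_eq[of u] cosh_square_eq[of v] by (simp add: power_mult_distrib)
  thus ?thesis by (simp add: power2_eq_square algebra_simps)
qed

lemma Re_csc_kernel:
  "Re (csc_kernel a y) =
     2 * pi\<^sup>2 * (1 - cos (2 * pi * a) * cosh (2 * pi * y)) / (cosh (2 * pi * y) - cos (2 * pi * a))\<^sup>2"
  unfolding csc_kernel_altdef by (simp add: Re_divide csc_kernel_denominator)

lemma cos_2pi_less_one:
  fixes a :: real
  assumes "0 < a" "a < 1"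
  shows "cos (2 * pi * a) < 1"
proof -
  have "cos (2 * pi * a) = 1 - 2 * (sin (pi * a))\<^sup>2"
    using cos_double_sin[of "pi * a"] by (simp add: mult_ac)
  moreover have "sin (pi * a) > 0" using assms by (intro sin_gt_zero) auto
  ultimately show ?thesis by simp
qed

text \<open>With \<open>c = cos (2 pi a) < 1\<close> the norm equals
  \<open>2 pi^2 / (cosh (2 pi y) - c)\<close>. The rate \<open>exp (- y)\<close> is weaker than the
  true one but matches the integrand of Gamma.\<close>

lemma norm_csc_kernel_le:
  assumes a: "0 < a" "a < 1"
  obtains C where "C > 0" "\<And>y. y \<ge> 0 \<Longrightarrow> norm (csc_kernel a y) \<le> C * exp (- y)"
proof
  \<comment> \<open>Truncation at 0 yields \<open>h - c \<ge> (1 - M) * h\<close> for every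
    \<open>h \<ge> 1\<close>, whatever the sign of \<open>c\<close>.\<close>
  define M where "M = max 0 (cos (2 * pi * a))"
  define m where "m = 1 - M"
  have M: "M \<ge> 0" "cos (2 * pi * a) \<le> M" by (simp_all add: M_def)
  have m: "m > 0" using cos_2pi_less_one[OF a] by (simp add: m_def M_def)
  show "4 * pi\<^sup>2 / m > 0" using m by simp
  fix y :: real assume y: "y \<ge> 0"
  define h where "h = cosh (2 * pi * y)"
  have h1: "h \<ge> 1" using cosh_real_ge_1[of "2 * pi * y"] by (simp add: h_def)
  have "1 * y \<le> 2 * pi * y" using y pi_gt3 by (intro mult_right_mono) auto
  hence "exp y \<le> exp (2 * pi * y)" by simp
  hence h2: "exp y / 2 \<le> h" by (simp add: h_def cosh_def add_increasing2)
  have "M * 1 \<le> M * h" using h1 M(1) by (rule mult_left_mono)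
  hence h3: "m * h \<le> h - cos (2 * pi * a)" using M(2) by (simp add: m_def algebra_simps)
  have "m * (exp y / 2) \<le> m * h" using h2 m by simp
  hence h4: "m * (exp y / 2) \<le> h - cos (2 * pi * a)" using h3 by linarith
  have h5: "m * (exp y / 2) > 0" using m by simp
  have h6: "h - cos (2 * pi * a) > 0" using h4 h5 by linarith
  have "cmod (Complex (1 - cos (2 * pi * a) * h) (sin (2 * pi * a) * sinh (2 * pi * y))) = \<bar>h - cos (2 * pi * a)\<bar>"
    unfolding h_def by (simp add: cmod_def csc_kernel_denominator)
  hence "norm (csc_kernel a y) = 2 * pi\<^sup>2 / \<bar>h - cos (2 * pi * a)\<bar>"
    unfolding csc_kernel_altdef h_def by (simp add: norm_divide norm_mult norm_power)
  also have "\<bar>h - cos (2 * pi * a)\<bar> = h - cos (2 * pi * a)"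
    using h6 by linarith
  also have "2 * pi\<^sup>2 / (h - cos (2 * pi * a)) \<le> 2 * pi\<^sup>2 / (m * (exp y / 2))"
    by (intro divide_left_mono mult_pos_pos h4 h6 m) simp_all
  also have "\<dots> = 4 * pi\<^sup>2 / m * exp (- y)" by (simp add: exp_minus field_simps)
  finally show "norm (csc_kernel a y) \<le> 4 * pi\<^sup>2 / m * exp (- y)" .
qed

subsection \<open>Mellin transforms\<close>

text \<open>Gives a majorant that is uniform for exponents in \<open>[l, u]\<close> and valid on
  both sides of \<open>x = 1\<close>, where the monotonicity in the exponent changes
  direction.\<close>

lemma powr_le_add_powr:
  fixes x l t u :: real
  assumes "x > 0" "l \<le> t" "t \<le> u"
  shows "x powr t \<le> x powr l + x powr u"
proof (cases "x \<le> 1")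
  case True
  hence "x powr t \<le> x powr l" using assms by (intro powr_mono') auto
  thus ?thesis by (simp add: add_increasing2)
next
  case False
  hence "x powr t \<le> x powr u" using assms by (intro powr_mono) auto
  thus ?thesis by (simp add: add_increasing)
qed


text \<open>The applications to zeta have \<open>w = 2 - s\<close>, which makes the weight
  \<open>y powr (1 - s)\<close>.\<close>

definition mellin :: "(real \<Rightarrow> complex) \<Rightarrow> complex \<Rightarrow> complex" where
  "mellin \<phi> w = integral {0<..} (\<lambda>y. of_real y powr (w - 1) * \<phi> y)"

text \<open>The integrand is bounded by a multiple of the integrand of
  \<open>Gamma (Re w)\<close>.\<close>

lemma mellin_integrand_integrable:
  assumes cont: "continuous_on {0<..} \<phi>" and bd: "\<And>y. y > 0 \<Longrightarrow> norm (\<phi> y) \<le> C * exp (- y)"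
    and w: "Re w > 0"
  shows "(\<lambda>y. of_real y powr (w - 1) * \<phi> y) integrable_on {0<..}"
proof (rule measurable_bounded_by_integrable_imp_integrable)
  show "(\<lambda>y. of_real y powr (w - 1) * \<phi> y) \<in> borel_measurable (lebesgue_on {0<..})"
    by (intro continuous_imp_measurable_on_sets_lebesgue continuous_intros cont) auto
  have "(\<lambda>t. t powr (Re w - 1) / exp t) integrable_on {0..}"
    using Gamma_integral_real[OF w] by (rule has_integral_integrable)
  hence "(\<lambda>t. t powr (Re w - 1) / exp t) integrable_on {0<..}"
    by (rule integrable_spike_set) (auto intro: negligible_subset[of "{0}"])
  thus "(\<lambda>y. C * (y powr (Re w - 1) / exp y)) integrable_on {0<..}"
    by (rule integrable_on_mult_right)
  show "norm (of_real y powr (w - 1) * \<phi> y) \<le> C * (y powr (Re w - 1) / exp y)" if "y \<in> {0<..}" for y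
  proof -
    have "norm (of_real y powr (w - 1) * \<phi> y) = y powr (Re w - 1) * norm (\<phi> y)"
      using that by (simp add: norm_mult norm_powr_real_powr)
    also have "\<dots> \<le> y powr (Re w - 1) * (C * exp (- y))"
      using that by (intro mult_left_mono bd) auto
    finally show ?thesis by (simp add: exp_minus divide_inverse mult_ac)
  qed
qed auto

text \<open>Integrals over compact intervals are holomorphic by differentiation under the integral
  sign. They converge uniformly on small discs, because one integrable function dominates the
  integrand for all \<open>w\<close> in the disc.\<close>

lemma holomorphic_mellin:
  assumes cont: "continuous_on {0<..} \<phi>" and bd: "\<And>y. y > 0 \<Longrightarrow> norm (\<phi> y) \<le> C * exp (- y)"
  shows "mellin \<phi> holomorphic_on {w. Re w > 0}"
proof (rule holomorphic_uniform_sequence)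
  define F where "F = (\<lambda>w y. complex_of_real y powr (w - 1) * \<phi> y)"
  \<comment> \<open>A compact exhaustion of the positive half-line that avoids 0, where the power
    may be singular.\<close>
  define S where "S = (\<lambda>n::nat. {1 / real (Suc n)..real (Suc n)})"
  have Spos: "y > 0" if "y \<in> S n" for y n
    using that less_le_trans[of 0 "1 / real (Suc n)" y] by (simp add: S_def)
  have contS: "continuous_on (S n) \<phi>" for n
    by (rule continuous_on_subset[OF cont]) (use Spos in auto)
  have F_S: "F w integrable_on S n" for w n
    unfolding F_def S_def
    by (intro integrable_continuous_interval continuous_intros contS[unfolded S_def])
      (use Spos[unfolded S_def] in fastforce)+
  show "open {w. Re w > 0}" by (rule open_halfspace_Re_gt)
  show "(\<lambda>w. integral (S n) (F w)) holomorphic_on {w. Re w > 0}" for n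
    unfolding S_def cbox_interval[symmetric]
  proof (rule leibniz_rule_holomorphic[where fx = "\<lambda>w t. exp ((w - 1) * of_real (ln t)) * of_real (ln t) * \<phi> t"])
    fix w t assume t: "t \<in> cbox (1 / real (Suc n)) (real (Suc n))"
    hence t0: "t > 0" using Spos[of t n] by (simp add: S_def)
    have e: "(\<lambda>w. F w t) = (\<lambda>w. exp ((w - 1) * of_real (ln t)) * \<phi> t)"
      using t0 by (auto simp: F_def powr_def Ln_of_real)
    show "((\<lambda>w. F w t) has_field_derivative exp ((w - 1) * of_real (ln t)) * of_real (ln t) * \<phi> t)
        (at w within {w. Re w > 0})"
      unfolding e by (auto intro!: derivative_eq_intros)
  next
    show "F w integrable_on cbox (1 / real (Suc n)) (real (Suc n))" for w
      using F_S[of w n] by (simp add: S_def)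
    have c1: "continuous_on ({w. Re w > 0} \<times> S n) (\<lambda>x. \<phi> (snd x))"
      by (rule continuous_on_compose2[OF contS[of n]]) (auto intro: continuous_intros)
    have c2: "continuous_on ({w. Re w > 0} \<times> S n) (\<lambda>x. ln (snd x))"
      by (intro continuous_intros) (use Spos in force)
    show "continuous_on ({w. Re w > 0} \<times> cbox (1 / real (Suc n)) (real (Suc n)))
        (\<lambda>(w, t). exp ((w - 1) * of_real (ln t)) * of_real (ln t) * \<phi> t)"
      using c1 c2 unfolding S_def case_prod_beta cbox_interval
      by (intro continuous_intros) (use Spos[unfolded S_def] in force)+
    show "convex {w. Re w > 0}" by (rule convex_halfspace_Re_gt)
  qed
  fix w0 assume "w0 \<in> {w. Re w > 0}"
  hence w0: "Re w0 > 0" by simp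
  \<comment> \<open>Half the distance to the imaginary axis, so that the exponents
    \<open>Re w0 - d\<close> and \<open>Re w0 + d\<close> both give convergent Gamma
    integrals.\<close>
  define d where "d = Re w0 / 2"
  have d: "d > 0" "Re w0 - d > 0" using w0 by (auto simp: d_def)
  have Re_bd: "Re w0 - d \<le> Re w" "Re w \<le> Re w0 + d" if "w \<in> cball w0 d" for w
    using that abs_Re_le_cmod[of "w0 - w"] by (auto simp: dist_norm abs_le_iff)
  define g where "g = (\<lambda>y. C * (y powr (Re w0 - d - 1) / exp y) + C * (y powr (Re w0 + d - 1) / exp y))"
  have C: "C \<ge> 0" using order.trans[OF norm_ge_zero bd[of 1]] by (simp add: zero_le_mult_iff)
  have g_nn: "g y \<ge> 0" for y using C by (simp add: g_def)
  have G: "(\<lambda>t. t powr (x - 1) / exp t) integrable_on {0<..}" if "x > 0" for x :: real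
    by (rule integrable_spike_set[OF has_integral_integrable[OF Gamma_integral_real[OF that]]])
      (auto intro: negligible_subset[of "{0}"])
  have g_int: "g integrable_on {0<..}"
    unfolding g_def using d by (intro integrable_add integrable_on_mult_right G) auto
  have F_le: "norm (F w y) \<le> g y" if "w \<in> cball w0 d" "y > 0" for w y
  proof -
    have "norm (F w y) = y powr (Re w - 1) * norm (\<phi> y)"
      using that by (simp add: F_def norm_mult norm_powr_real_powr)
    also have "\<dots> \<le> (y powr (Re w0 - d - 1) + y powr (Re w0 + d - 1)) * (C * exp (- y))"
      using Re_bd[OF that(1)] that by (intro mult_mono powr_le_add_powr bd) auto
    finally show ?thesis by (simp add: g_def exp_minus divide_inverse algebra_simps)
  qed
  define gS where "gS = (\<lambda>n y. if y \<in> S n then g y else 0)"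
  have gS_int: "gS n integrable_on {0<..}" for n
  proof -
    have "g integrable_on S n"
      using g_int unfolding S_def by (rule integrable_on_subinterval) (use Spos in \<open>auto simp: S_def\<close>)
    moreover have "S n \<inter> {0<..} = S n" using Spos by auto
    ultimately show ?thesis
      unfolding gS_def by (subst integrable_restrict_Int) simp
  qed
  \<comment> \<open>The part of the integral of \<open>g\<close> outside \<open>S n\<close> tends to
    0; it bounds the truncation error for every \<open>w\<close> in the disc.\<close>
  have lim: "(\<lambda>n. integral {0<..} (gS n)) \<longlonglongrightarrow> integral {0<..} g"
  proof (rule dominated_convergence(2)[OF gS_int g_int])
    show "norm (gS n y) \<le> g y" if "y \<in> {0<..}" for n y
      using g_nn by (simp add: gS_def)
    show "(\<lambda>n. gS n y) \<longlonglongrightarrow> g y" if "y \<in> {0<..}" for y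
    proof (rule tendsto_eventually)
      have y: "y > 0" using that by simp
      obtain N :: nat where N: "real N > y + 1 / y" using reals_Archimedean2 by blast
      show "eventually (\<lambda>n. gS n y = g y) sequentially"
        using eventually_ge_at_top[of N]
      proof eventually_elim
        fix n assume n: "n \<ge> N"
        have "real (Suc n) \<ge> y + 1 / y" using n N by simp
        moreover have "y > 0" "1 / y > 0" using y by auto
        ultimately have "real (Suc n) \<ge> y" "real (Suc n) \<ge> 1 / y" by linarith+
        hence "y \<in> S n" using y by (simp add: S_def field_simps)
        thus "gS n y = g y" by (simp add: gS_def)
      qed
    qed
  qed
  show "\<exists>d>0. cball w0 d \<subseteq> {w. Re w > 0} \<and>
     uniform_limit (cball w0 d) (\<lambda>n w. integral (S n) (F w)) (mellin \<phi>) sequentially"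
  proof (intro exI[of _ d] conjI)
    show "cball w0 d \<subseteq> {w. Re w > 0}" using Re_bd d by force
    show "uniform_limit (cball w0 d) (\<lambda>n w. integral (S n) (F w)) (mellin \<phi>) sequentially"
    proof (rule uniform_limitI)
      fix e :: real assume e: "e > 0"
      have "eventually (\<lambda>n. dist (integral {0<..} (gS n)) (integral {0<..} g) < e) sequentially"
        using lim e by (rule tendstoD)
      thus "eventually (\<lambda>n. \<forall>w\<in>cball w0 d. dist (integral (S n) (F w)) (mellin \<phi> w) < e) sequentially"
      proof eventually_elim
        fix n assume n: "dist (integral {0<..} (gS n)) (integral {0<..} g) < e"
        show "\<forall>w\<in>cball w0 d. dist (integral (S n) (F w)) (mellin \<phi> w) < e"
        proof
          fix w assume w: "w \<in> cball w0 d"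
          have "Re w > 0" using Re_bd[OF w] d by linarith
          from mellin_integrand_integrable[OF cont bd this]
          have Fi: "F w integrable_on {0<..}" by (simp add: F_def)
          have SI: "S n \<inter> {0<..} = S n" using Spos by auto
          have FSi: "(\<lambda>y. if y \<in> S n then F w y else 0) integrable_on {0<..}"
            by (subst integrable_restrict_Int) (simp add: SI F_S)
          have "integral (S n) (F w) = integral {0<..} (\<lambda>y. if y \<in> S n then F w y else 0)"
            by (subst integral_restrict_Int) (simp add: SI)
          moreover have "mellin \<phi> w = integral {0<..} (F w)" by (simp add: mellin_def F_def)
          ultimately have "norm (mellin \<phi> w - integral (S n) (F w)) =
              norm (integral {0<..} (\<lambda>y. F w y - (if y \<in> S n then F w y else 0)))"
            by (simp add: integral_diff[OF Fi FSi])
          also have "\<dots> \<le> integral {0<..} (\<lambda>y. g y - gS n y)"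
            by (intro integral_norm_bound_integral integrable_diff Fi FSi g_int gS_int)
              (auto simp: gS_def F_le[OF w])
          also have "\<dots> = integral {0<..} g - integral {0<..} (gS n)"
            by (rule integral_diff[OF g_int gS_int])
          also have "\<dots> < e" using n by (simp add: dist_real_def)
          finally show "dist (integral (S n) (F w)) (mellin \<phi> w) < e"
            by (simp add: dist_norm norm_minus_commute)
        qed
      qed
    qed
  qed (use d in auto)
qed

subsection \<open>The Hurwitz series\<close>

text \<open>Kept apart from \<open>hurwitz_zeta\<close>, which is a definite description: the series
  can be used before the continuation is known to exist.\<close>

definition hurwitz_series :: "real \<Rightarrow> complex \<Rightarrow> complex" where
  "hurwitz_series a s = (\<Sum>n. complex_of_real (real n + a) powr (- s))"

lemma summable_shifted_powr:
  fixes a s :: real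
  assumes "a > 0" "s > 1"
  shows "summable (\<lambda>n. (real n + a) powr (- s))"
proof (rule summable_comparison_test_ev)
  show "summable (\<lambda>n. real n powr (- s))"
    using assms by (simp add: summable_real_powr_iff)
  show "eventually (\<lambda>n. norm ((real n + a) powr (- s)) \<le> real n powr (- s)) sequentially"
    using eventually_gt_at_top[of 0]
    by eventually_elim (use assms in \<open>auto intro!: powr_mono2'\<close>)
qed

lemma norm_shifted_powr:
  assumes "a > 0"
  shows "norm (complex_of_real (real n + a) powr (- s)) = (real n + a) powr (- Re s)"
proof -
  have "0 < real n + a" using assms by (simp add: add_nonneg_pos)
  thus ?thesis
    by (subst norm_powr_real_powr)
      (simp_all only: Re_complex_of_real less_imp_le uminus_complex.sel Reals_of_real)
qed

lemma hurwitz_series_sums: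
  assumes "a > 0" "Re s > 1"
  shows "(\<lambda>n. complex_of_real (real n + a) powr (- s)) sums hurwitz_series a s"
  unfolding hurwitz_series_def
proof (rule summable_sums, rule summable_norm_cancel)
  show "summable (\<lambda>n. norm (complex_of_real (real n + a) powr (- s)))"
    unfolding norm_shifted_powr[OF assms(1)] using assms by (rule summable_shifted_powr)
qed

lemma hurwitz_series_of_real:
  assumes "a > 0" "s > 1"
  shows "hurwitz_series a (of_real s) = of_real (\<Sum>n. (real n + a) powr (- s))"
proof -
  have e: "complex_of_real (real n + a) powr (- of_real s) = of_real ((real n + a) powr (- s))" for n
    using assms powr_of_real[of "real n + a" "- s"] by simp
  show ?thesis
    unfolding hurwitz_series_def e
    using summable_shifted_powr[OF assms] by (rule suminf_of_real[symmetric])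
qed

lemma suminf_shifted_powr_pos:
  fixes a s :: real
  assumes "a > 0" "s > 1"
  shows "(\<Sum>n. (real n + a) powr (- s)) > 0"
  using summable_shifted_powr[OF assms] assms by (intro suminf_pos) auto

text \<open>The Weierstrass test gives uniform convergence of the holomorphic partial sums on closed
  discs inside the half-plane.\<close>

lemma holomorphic_hurwitz_series:
  assumes a: "a > 0"
  shows "hurwitz_series a holomorphic_on {s. Re s > 1}"
proof (rule holomorphic_uniform_sequence)
  show "open {s. Re s > 1}" by (rule open_halfspace_Re_gt)
  show "(\<lambda>s. \<Sum>n<N. complex_of_real (real n + a) powr (- s)) holomorphic_on {s. Re s > 1}" for N
    by (intro holomorphic_intros)
next
  fix s assume "s \<in> {s. Re s > 1}"
  hence s: "Re s > 1" by simp
  define d where "d = (Re s - 1) / 2"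
  have d: "d > 0" "Re s - d > 1" using s by (auto simp: d_def field_simps)
  have bd: "Re s - d \<le> Re w" "Re w \<le> Re s + d" if "w \<in> cball s d" for w
    using that abs_Re_le_cmod[of "s - w"] by (auto simp: dist_norm abs_le_iff)
  show "\<exists>d>0. cball s d \<subseteq> {s. Re s > 1} \<and>
     uniform_limit (cball s d) (\<lambda>N s. \<Sum>n<N. complex_of_real (real n + a) powr (- s)) (hurwitz_series a) sequentially"
  proof (intro exI[of _ d] conjI)
    show "cball s d \<subseteq> {s. Re s > 1}"
    proof
      fix w assume "w \<in> cball s d"
      from bd(1)[OF this] d(2) show "w \<in> {s. Re s > 1}" by simp
    qed
    show "uniform_limit (cball s d) (\<lambda>N s. \<Sum>n<N. complex_of_real (real n + a) powr (- s)) (hurwitz_series a) sequentially"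
      unfolding hurwitz_series_def
    proof (rule Weierstrass_m_test)
      show "summable (\<lambda>n. (real n + a) powr (- (Re s + d)) + (real n + a) powr (- (Re s - d)))"
        using a d by (intro summable_add summable_shifted_powr) auto
      show "norm (complex_of_real (real n + a) powr (- w)) \<le>
          (real n + a) powr (- (Re s + d)) + (real n + a) powr (- (Re s - d))"
        if "w \<in> cball s d" for n w
        unfolding norm_shifted_powr[OF a]
        by (rule powr_le_add_powr) (use bd[OF that] a in \<open>simp_all add: add_nonneg_pos\<close>)
    qed
  qed (use d in auto)
qed

lemma cmod_inverse_Complex_square: "cmod (1 / (Complex b y)\<^sup>2) = 1 / (b\<^sup>2 + y\<^sup>2)"
  by (simp add: norm_divide norm_power cmod_power2)

text \<open>Termwise integration of the partial fraction expansion. Monotone convergence shows that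
  the sum of the moduli is integrable; this sum then dominates the partial sums.\<close>

lemma has_integral_csc_kernel:
  assumes a: "0 < a" "a < 1" and s: "1 < s" "s < 2"
  shows "((\<lambda>y. of_real (y powr (1 - s)) * csc_kernel a y) has_integral
     (mellin_kappa s * hurwitz_series a (of_real s) +
      cnj (mellin_kappa s) * hurwitz_series (1 - a) (of_real s))) {0<..}"
proof -
  define b b' where "b = (\<lambda>n::nat. real n + a)" and "b' = (\<lambda>n::nat. real n + (1 - a))"
  have bpos: "b n > 0" "b' n > 0" for n using a by (simp_all add: b_def b'_def add_nonneg_pos)
  have s0: "0 < s" using s by simp
  define c where "c = Beta (1 - s/2) (s/2) / 2"
  define g where "g = (\<lambda>n y. y powr (1 - s) / ((b n)\<^sup>2 + y\<^sup>2) + y powr (1 - s) / ((b' n)\<^sup>2 + y\<^sup>2))"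
  define f where "f = (\<lambda>n y. complex_of_real (y powr (1 - s)) / (Complex (b n) y)\<^sup>2 +
      cnj (complex_of_real (y powr (1 - s)) / (Complex (b' n) y)\<^sup>2))"
  have sm: "summable (\<lambda>n. b n powr (- s))" "summable (\<lambda>n. b' n powr (- s))"
    unfolding b_def b'_def using a s by (auto intro!: summable_shifted_powr)
  have g_int: "(g n has_integral (c * b n powr (- s) + c * b' n powr (- s))) {0<..}" for n
    unfolding g_def c_def
    by (intro has_integral_add has_integral_powr_over_sum_squares bpos s0 s)
  have f_int: "(f n has_integral (of_real (b n powr (- s)) * mellin_kappa s +
      cnj (of_real (b' n powr (- s)) * mellin_kappa s))) {0<..}" for n
    unfolding f_def
    using has_integral_add[OF has_integral_powr_over_square[OF bpos(1) s]
        has_integral_linear[OF has_integral_powr_over_square[OF bpos(2) s] bounded_linear_cnj]]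
    by (simp only: o_def)
  have g_nn: "g n y \<ge> 0" for n y by (auto simp: g_def)
  have g_sum: "summable (\<lambda>n. g n y)" for y
  proof -
    have "summable (\<lambda>n. y powr (1 - s) / ((real n + u)\<^sup>2 + y\<^sup>2))" if "u > 0" for u :: real
    proof (rule summable_comparison_test)
      show "summable (\<lambda>n. y powr (1 - s) * (real n + u) powr (- 2))"
        using that by (intro summable_mult summable_shifted_powr) auto
      have "norm (y powr (1 - s) / ((real n + u)\<^sup>2 + y\<^sup>2)) \<le> y powr (1 - s) * (real n + u) powr (- 2)" for n
      proof -
        have "(real n + u)\<^sup>2 > 0" using that by simp
        hence "y powr (1 - s) / ((real n + u)\<^sup>2 + y\<^sup>2) \<le> y powr (1 - s) / (real n + u)\<^sup>2"
          by (intro divide_left_mono mult_pos_pos add_pos_nonneg) auto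
        also have "\<dots> = y powr (1 - s) * (real n + u) powr (- 2)"
          using that by (simp add: powr_minus_divide)
        finally show ?thesis by simp
      qed
      thus "\<exists>N. \<forall>n\<ge>N. norm (y powr (1 - s) / ((real n + u)\<^sup>2 + y\<^sup>2)) \<le> y powr (1 - s) * (real n + u) powr (- 2)"
        by blast
    qed
    thus ?thesis unfolding g_def b_def b'_def using a by (intro summable_add) auto
  qed
  have "(\<lambda>n. c * b n powr (- s) + c * b' n powr (- s)) sums
      (\<Sum>n. c * b n powr (- s) + c * b' n powr (- s))"
    by (intro summable_sums summable_add summable_mult sm)
  hence lim: "(\<lambda>N. \<Sum>n<N. c * b n powr (- s) + c * b' n powr (- s)) \<longlonglongrightarrow>
      (\<Sum>n. c * b n powr (- s) + c * b' n powr (- s))"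
    by (simp only: sums_def)
  \<comment> \<open>The integrals of the \<open>g n\<close> are multiples of
    \<open>b n powr (- s)\<close> and \<open>b' n powr (- s)\<close>, hence summable because
    \<open>s > 1\<close>.\<close>
  have "((\<lambda>y. \<Sum>n. g n y) has_integral (\<Sum>n. c * b n powr (- s) + c * b' n powr (- s))) {0<..}"
  proof (rule has_integral_monotone_convergence_increasing[OF _ _ _ lim])
    show "((\<lambda>y. \<Sum>n<N. g n y) has_integral (\<Sum>n<N. c * b n powr (- s) + c * b' n powr (- s))) {0<..}" for N
      by (rule has_integral_sum[OF _ g_int]) simp
    show "(\<Sum>n<N. g n y) \<le> (\<Sum>n<Suc N. g n y)" for N y
      using g_nn[of N y] by simp
    show "(\<lambda>N. \<Sum>n<N. g n y) \<longlonglongrightarrow> (\<Sum>n. g n y)" for y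
      by (rule summable_LIMSEQ[OF g_sum])
  qed
  hence G: "(\<lambda>y. \<Sum>n. g n y) integrable_on {0<..}" by (rule has_integral_integrable)
  show ?thesis
  proof (rule has_integral_dominated_convergence[OF _ G])
    show "((\<lambda>y. \<Sum>n<N. f n y) has_integral (\<Sum>n<N. of_real (b n powr (- s)) * mellin_kappa s +
      cnj (of_real (b' n powr (- s)) * mellin_kappa s))) {0<..}" for N
      by (rule has_integral_sum[OF _ f_int]) simp
    show "\<forall>y\<in>{0<..}. norm (\<Sum>n<N. f n y) \<le> (\<Sum>n. g n y)" for N
    proof
      fix y :: real
      have e: "complex_of_real (y powr (1 - s)) / (Complex u y)\<^sup>2 = of_real (y powr (1 - s)) * (1 / (Complex u y)\<^sup>2)" for u
        by simp
      have n: "norm (complex_of_real (y powr (1 - s)) / (Complex u y)\<^sup>2) = y powr (1 - s) / (u\<^sup>2 + y\<^sup>2)" for u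
        unfolding e norm_mult cmod_inverse_Complex_square by simp
      have "norm (f n y) \<le> g n y" for n
        unfolding f_def g_def by (rule order.trans[OF norm_triangle_ineq]) (simp add: n del: complex_cnj_divide)
      hence "norm (\<Sum>n<N. f n y) \<le> (\<Sum>n<N. g n y)" by (intro sum_norm_le)
      also have "\<dots> \<le> (\<Sum>n. g n y)" by (intro sum_le_suminf g_sum g_nn) auto
      finally show "norm (\<Sum>n<N. f n y) \<le> (\<Sum>n. g n y)" .
    qed
    show "\<forall>y\<in>{0<..}. (\<lambda>N. \<Sum>n<N. f n y) \<longlonglongrightarrow> of_real (y powr (1 - s)) * csc_kernel a y"
    proof
      fix y :: real
      from sums_mult[OF csc_kernel_sums[OF a, of y], of "of_real (y powr (1 - s))"]
      show "(\<lambda>N. \<Sum>n<N. f n y) \<longlonglongrightarrow> of_real (y powr (1 - s)) * csc_kernel a y"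
        unfolding sums_def f_def b_def b'_def by (simp add: distrib_left)
    qed
    have S: "(\<lambda>n. complex_of_real ((real n + u) powr (- s))) sums hurwitz_series u (of_real s)" if "u > 0" for u
      unfolding hurwitz_series_of_real[OF that s(1)]
      using summable_shifted_powr[OF that s(1)] by (intro sums_of_real summable_sums)
    have "(\<lambda>n. of_real (b n powr (- s)) * mellin_kappa s + of_real (b' n powr (- s)) * cnj (mellin_kappa s)) sums
        (hurwitz_series a (of_real s) * mellin_kappa s + hurwitz_series (1 - a) (of_real s) * cnj (mellin_kappa s))"
      unfolding b_def b'_def using a by (intro sums_add sums_mult2 S) auto
    thus "(\<lambda>N. \<Sum>n<N. of_real (b n powr (- s)) * mellin_kappa s +
      cnj (of_real (b' n powr (- s)) * mellin_kappa s)) \<longlonglongrightarrow>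
      mellin_kappa s * hurwitz_series a (of_real s) +
      cnj (mellin_kappa s) * hurwitz_series (1 - a) (of_real s)"
      unfolding sums_def by (simp add: mult.commute)
  qed
qed

subsection \<open>Analytic continuation\<close>

text \<open>The real part is taken of the kernel and not of the transform, so that the result stays
  holomorphic in the complex argument.\<close>

definition Re_mellin :: "real \<Rightarrow> complex \<Rightarrow> complex" where
  "Re_mellin a = mellin (\<lambda>y. of_real (Re (csc_kernel a y)))"

definition Im_mellin :: "real \<Rightarrow> complex \<Rightarrow> complex" where
  "Im_mellin a = mellin (\<lambda>y. of_real (Im (csc_kernel a y)))"

lemma holomorphic_Re_mellin:
  assumes "0 < a" "a < 1"
  shows "Re_mellin a holomorphic_on {w. Re w > 0}"
proof -
  obtain C where C: "\<And>y. y \<ge> 0 \<Longrightarrow> norm (csc_kernel a y) \<le> C * exp (- y)"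
    using norm_csc_kernel_le[OF assms] by metis
  show ?thesis unfolding Re_mellin_def
  proof (rule holomorphic_mellin)
    show "norm (complex_of_real (Re (csc_kernel a y))) \<le> C * exp (- y)" if "y > 0" for y
      using order.trans[OF abs_Re_le_cmod C] that by simp
  qed (intro continuous_intros continuous_on_csc_kernel assms)
qed

lemma holomorphic_Im_mellin:
  assumes "0 < a" "a < 1"
  shows "Im_mellin a holomorphic_on {w. Re w > 0}"
proof -
  obtain C where C: "\<And>y. y \<ge> 0 \<Longrightarrow> norm (csc_kernel a y) \<le> C * exp (- y)"
    using norm_csc_kernel_le[OF assms] by metis
  show ?thesis unfolding Im_mellin_def
  proof (rule holomorphic_mellin)
    show "norm (complex_of_real (Im (csc_kernel a y))) \<le> C * exp (- y)" if "y > 0" for y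
      using order.trans[OF abs_Im_le_cmod C] that by simp
  qed (intro continuous_intros continuous_on_csc_kernel assms)
qed

lemma Re_mellin_reflect: "Re_mellin (1 - a) = Re_mellin a"
  by (simp add: Re_mellin_def csc_kernel_reflect)

lemma Im_mellin_reflect: "Im_mellin (1 - a) w = - Im_mellin a w"
  by (simp add: Im_mellin_def mellin_def csc_kernel_reflect)

lemma of_real_powr_mellin:
  "y > 0 \<Longrightarrow> complex_of_real y powr (1 - of_real s) = of_real (y powr (1 - s))"
  using powr_of_real[of y "1 - s"] by simp

text \<open>The sums \<open>T a\<close> and \<open>T (1 - a)\<close> are real, so these are the real
  and imaginary parts of
  \<open>mellin_kappa s * T a + cnj (mellin_kappa s) * T (1 - a)\<close>.\<close>

lemma
  assumes a: "0 < a" "a < 1" and s: "1 < s" "s < 2"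
  defines "T \<equiv> \<lambda>u. \<Sum>n. (real n + u) powr (- s)"
  shows Re_mellin_strip: "Re_mellin a (2 - of_real s) = of_real ((s - 1) * pi / (2 * sin (pi * s / 2)) * (T a + T (1 - a)))"
    and Im_mellin_strip: "Im_mellin a (2 - of_real s) = of_real ((s - 1) * pi / (2 * cos (pi * s / 2)) * (T a - T (1 - a)))"
proof -
  have hs: "hurwitz_series a (of_real s) = of_real (T a)" "hurwitz_series (1 - a) (of_real s) = of_real (T (1 - a))"
    using a s by (simp_all add: hurwitz_series_of_real T_def)
  note int = has_integral_csc_kernel[OF a s, unfolded hs]
  define X Y where "X = (s - 1) * pi / (2 * sin (pi * s / 2))" and "Y = (s - 1) * pi / (2 * cos (pi * s / 2))"
  have k: "mellin_kappa s = Complex X Y" by (simp add: mellin_kappa_def X_def Y_def)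
  have "((\<lambda>y. complex_of_real y powr (2 - of_real s - 1) * of_real (Re (csc_kernel a y))) has_integral
      of_real (X * (T a + T (1 - a)))) {0<..}"
    using has_integral_of_real[OF has_integral_Re[OF int], where 'b = complex]
    by (rule has_integral_eq_rhs[OF has_integral_eq[rotated]])
      (simp_all add: of_real_powr_mellin k distrib_left right_diff_distrib)
  thus "Re_mellin a (2 - of_real s) = of_real ((s - 1) * pi / (2 * sin (pi * s / 2)) * (T a + T (1 - a)))"
    unfolding Re_mellin_def mellin_def X_def[symmetric] by (rule integral_unique)
  have "((\<lambda>y. complex_of_real y powr (2 - of_real s - 1) * of_real (Im (csc_kernel a y))) has_integral
      of_real (Y * (T a - T (1 - a)))) {0<..}"
    using has_integral_of_real[OF has_integral_Im[OF int], where 'b = complex]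
    by (rule has_integral_eq_rhs[OF has_integral_eq[rotated]])
      (simp_all add: of_real_powr_mellin k distrib_left right_diff_distrib)
  thus "Im_mellin a (2 - of_real s) = of_real ((s - 1) * pi / (2 * cos (pi * s / 2)) * (T a - T (1 - a)))"
    unfolding Im_mellin_def mellin_def Y_def[symmetric] by (rule integral_unique)
qed

text \<open>The combination that eliminates \<open>T (1 - a)\<close> from the two strip formulas;
  what remains is \<open>pi * (s - 1) * T a\<close>.\<close>

definition hurwitz_left :: "real \<Rightarrow> complex \<Rightarrow> complex" where
  "hurwitz_left a s = sin (of_real pi * s / 2) * Re_mellin a (2 - s)
                     + cos (of_real pi * s / 2) * Im_mellin a (2 - s)"

lemma holomorphic_hurwitz_left:
  assumes a: "0 < a" "a < 1"
  shows "hurwitz_left a holomorphic_on {s. Re s < 2}"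
proof -
  have "(\<lambda>s. Re_mellin a (2 - s)) holomorphic_on {s. Re s < 2}"
    "(\<lambda>s. Im_mellin a (2 - s)) holomorphic_on {s. Re s < 2}"
    by (auto intro!: holomorphic_on_compose_gen[OF _ holomorphic_Re_mellin[OF a], unfolded o_def]
      holomorphic_on_compose_gen[OF _ holomorphic_Im_mellin[OF a], unfolded o_def] holomorphic_intros)
  thus ?thesis unfolding hurwitz_left_def by (intro holomorphic_intros) auto
qed

lemma hurwitz_left_of_real:
  assumes a: "0 < a" "a < 1" and s: "1 < s" "s < 2"
  shows "hurwitz_left a (of_real s) = of_real pi * (of_real s - 1) * hurwitz_series a (of_real s)"
proof -
  have sn: "sin (pi * s / 2) > 0" using s by (intro sin_gt_zero) auto
  have cs: "cos (pi * s / 2) < 0"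
  proof -
    have "cos (pi * (2 - s) / 2) > 0" using s by (intro cos_gt_zero_pi) (auto simp: field_simps)
    moreover have "pi * (2 - s) / 2 = pi - pi * s / 2" by (simp add: field_simps)
    ultimately show ?thesis by simp
  qed
  have e: "sin (complex_of_real pi * of_real s / 2) = of_real (sin (pi * s / 2))"
    "cos (complex_of_real pi * of_real s / 2) = of_real (cos (pi * s / 2))"
    by (simp_all add: sin_of_real[symmetric] cos_of_real[symmetric])
  define A B where "A = (\<Sum>n. (real n + a) powr (- s))" and "B = (\<Sum>n. (real n + (1 - a)) powr (- s))"
  have "sin (pi * s / 2) * ((s - 1) * pi / (2 * sin (pi * s / 2)) * (A + B))
      + cos (pi * s / 2) * ((s - 1) * pi / (2 * cos (pi * s / 2)) * (A - B)) = pi * (s - 1) * A"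
    using sn cs by (simp add: field_simps)
  from arg_cong[OF this, of complex_of_real] show ?thesis
    unfolding hurwitz_left_def e Re_mellin_strip[OF assms] Im_mellin_strip[OF assms]
      hurwitz_series_of_real[OF a(1) s(1)] A_def[symmetric] B_def[symmetric]
    by (simp only: of_real_add of_real_mult of_real_diff of_real_1)
qed

text \<open>The identity theorem on the strip: both sides are holomorphic and agree on the real
  segment from 1 to 2, which accumulates at \<open>3/2\<close>.\<close>

lemma hurwitz_left_eq:
  assumes a: "0 < a" "a < 1" and s: "1 < Re s" "Re s < 2"
  shows "hurwitz_left a s = of_real pi * (s - 1) * hurwitz_series a s"
proof -
  let ?S = "{s. Re s > 1} \<inter> {s. Re s < 2}"
  define f where "f = (\<lambda>s. hurwitz_left a s - of_real pi * (s - 1) * hurwitz_series a s)"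
  have "f s = 0"
  proof (rule analytic_continuation[where S = ?S and f = f and U = "complex_of_real ` {1<..<2}" and \<xi> = "of_real (3/2)"])
    show "f holomorphic_on ?S" unfolding f_def
      by (intro holomorphic_intros holomorphic_on_subset[OF holomorphic_hurwitz_left[OF a]]
          holomorphic_on_subset[OF holomorphic_hurwitz_series[OF a(1)]]) auto
    show "open ?S" by (intro open_Int open_halfspace_Re_gt open_halfspace_Re_lt)
    show "connected ?S"
      by (intro convex_connected convex_Int convex_halfspace_Re_gt convex_halfspace_Re_lt)
    show "complex_of_real (3/2) islimpt complex_of_real ` {1<..<2}"
    proof (rule islimpt_isCont_image)
      show "(3/2::real) islimpt {1<..<2}" by (intro open_imp_islimpt) auto
      show "\<forall>\<^sub>F x in at (3/2). complex_of_real x \<noteq> complex_of_real (3/2)"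
        by (simp only: of_real_eq_iff eventually_at_filter) simp
    qed simp
    show "f z = 0" if "z \<in> complex_of_real ` {1<..<2}" for z
      using that hurwitz_left_of_real[OF a] by (auto simp: f_def)
  qed (use s in auto)
  thus ?thesis by (simp add: f_def)
qed

text \<open>This is \<open>\<pi> (s - 1) \<zeta>(s, a)\<close>.\<close>

definition hurwitz_entire :: "real \<Rightarrow> complex \<Rightarrow> complex" where
  "hurwitz_entire a s = (if s \<in> {s. Re s > 1} then of_real pi * (s - 1) * hurwitz_series a s else hurwitz_left a s)"

lemma hurwitz_entire_left:
  assumes "0 < a" "a < 1" "Re s < 2"
  shows "hurwitz_entire a s = hurwitz_left a s"
  using hurwitz_left_eq[of a s] assms by (simp add: hurwitz_entire_def)

text \<open>The two branches are holomorphic on overlapping half-planes that cover the plane, and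
  they agree on the overlap.\<close>

lemma holomorphic_hurwitz_entire:
  assumes a: "0 < a" "a < 1"
  shows "hurwitz_entire a holomorphic_on UNIV"
proof -
  have "hurwitz_entire a holomorphic_on {s. Re s > 1} \<union> {s. Re s < 2}"
    unfolding hurwitz_entire_def
    by (intro holomorphic_on_If_Un holomorphic_intros holomorphic_hurwitz_series holomorphic_hurwitz_left a
        open_halfspace_Re_gt open_halfspace_Re_lt) (use hurwitz_left_eq[OF a] in auto)
  moreover have "{s. Re s > 1} \<union> {s. Re s < 2} = UNIV" by auto
  ultimately show ?thesis by simp
qed

text \<open>The quotient has the properties that characterise \<open>hurwitz_zeta\<close>, and
  uniqueness of the continuation identifies the two.\<close>

lemma hurwitz_zeta_eq:
  assumes a: "0 < a" "a < 1"
  shows "s \<noteq> 1 \<Longrightarrow> hurwitz_zeta a s = hurwitz_entire a s / (of_real pi * (s - 1))"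
proof -
  define F where "F = (\<lambda>s. hurwitz_entire a s / (of_real pi * (s - 1)))"
  \<comment> \<open>Normalises the value at \<open>s = 1\<close>, as
    \<open>nicely_meromorphic_on\<close> requires.\<close>
  define G where "G = remove_sings F"
  have ent: "hurwitz_entire a analytic_on UNIV"
    using holomorphic_hurwitz_entire[OF a] by (simp add: analytic_on_open)
  have "F meromorphic_on UNIV" unfolding F_def
    by (intro meromorphic_intros analytic_on_imp_meromorphic_on ent)
  hence nice: "G nicely_meromorphic_on UNIV"
    unfolding G_def by (rule remove_sings_nicely_meromorphic)
  have GF: "G s = F s" if "s \<noteq> 1" for s
  proof -
    have "F analytic_on {s}" unfolding F_def
      by (intro analytic_intros analytic_on_subset[OF ent]) (use that in auto)
    thus ?thesis unfolding G_def by (rule remove_sings_at_analytic)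
  qed
  have sums: "(\<lambda>n. complex_of_real (real n + a) powr (- s)) sums G s" if "Re s > 1" for s
  proof -
    have s1: "s \<noteq> 1" using that by auto
    hence "G s = hurwitz_series a s"
      using that by (simp add: GF F_def hurwitz_entire_def)
    thus ?thesis using hurwitz_series_sums[OF a(1) that] by simp
  qed
  have "hurwitz_zeta a = G" unfolding hurwitz_zeta_def
  proof (rule the_equality)
    show "G nicely_meromorphic_on UNIV \<and>
      (\<forall>s. Re s > 1 \<longrightarrow> (\<lambda>n. complex_of_real (real n + a) powr (- s)) sums G s)"
      using nice sums by blast
  next
    fix f assume f: "f nicely_meromorphic_on UNIV \<and>
      (\<forall>s. Re s > 1 \<longrightarrow> (\<lambda>n. complex_of_real (real n + a) powr (- s)) sums f s)"
    show "f = G"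
      by (rule nicely_meromorphic_continuation_unique[where c = 1])
        (use f nice sums sums_unique2 in blast)+
  qed
  thus "s \<noteq> 1 \<Longrightarrow> hurwitz_zeta a s = hurwitz_entire a s / (of_real pi * (s - 1))"
    using GF by (simp add: F_def)
qed

lemma hurwitz_zeta_eq_series:
  assumes a: "0 < a" "a < 1" and s: "Re s > 1"
  shows "hurwitz_zeta a s = hurwitz_series a s"
proof -
  have s1: "s \<noteq> 1" using s by auto
  show ?thesis unfolding hurwitz_zeta_eq[OF a s1]
    using s s1 by (simp add: hurwitz_entire_def)
qed

text \<open>Under \<open>a\<close> to \<open>1 - a\<close> the function \<open>Re_mellin\<close> is
  invariant and \<open>Im_mellin\<close> changes sign, so the cosine terms cancel and the sine terms
  double.\<close>

lemma hurwitz_Z_eq: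
  assumes a: "0 < a" "a < 1" and s: "Re s < 2" "s \<noteq> 1"
  shows "hurwitz_Z a s = 2 * sin (of_real pi * s / 2) / (of_real pi * (s - 1)) * Re_mellin a (2 - s)"
proof -
  have a': "0 < 1 - a" "1 - a < 1" using a by auto
  show ?thesis
    unfolding hurwitz_Z_def hurwitz_zeta_eq[OF a s(2)] hurwitz_zeta_eq[OF a' s(2)]
      hurwitz_entire_left[OF a s(1)] hurwitz_entire_left[OF a' s(1)] hurwitz_left_def
      Re_mellin_reflect Im_mellin_reflect
    by (simp add: add_divide_distrib[symmetric])
qed

subsection \<open>The sign of the real part\<close>

text \<open>The sum dominates the integral of \<open>x powr (- s)\<close> from \<open>a\<close> to
  infinity. The comparison is made by telescoping \<open>x powr (1 - s)\<close> and applying the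
  mean value theorem to each difference.\<close>

lemma suminf_shifted_powr_ge:
  fixes a s :: real
  assumes a: "a > 0" and s: "s > 1"
  shows "a powr (1 - s) \<le> (s - 1) * (\<Sum>n. (real n + a) powr (- s))"
proof -
  have lim: "(\<lambda>n. (real n + a) powr (1 - s)) \<longlonglongrightarrow> 0"
  proof (rule tendsto_neg_powr)
    show "filterlim (\<lambda>n. real n + a) at_top sequentially"
      using filterlim_tendsto_add_at_top[OF tendsto_const[of a] filterlim_real_sequentially]
      by (simp add: add.commute)
  qed (use s in simp)
  have tel: "(\<lambda>n. (real n + a) powr (1 - s) - (real (Suc n) + a) powr (1 - s)) sums a powr (1 - s)"
    using telescope_sums'[OF lim] by simp
  have le: "(real n + a) powr (1 - s) - (real (Suc n) + a) powr (1 - s) \<le> (s - 1) * (real n + a) powr (- s)" for n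
  proof -
    let ?x = "real n + a"
    have x: "?x > 0" using a by (simp add: add_nonneg_pos)
    have "\<exists>z>?x. z < ?x + 1 \<and> (?x + 1) powr (1 - s) - ?x powr (1 - s) = (?x + 1 - ?x) * ((1 - s) * z powr (1 - s - 1))"
      using x by (intro MVT2) (auto intro!: derivative_eq_intros)
    then obtain z where z: "z > ?x"
      "(?x + 1) powr (1 - s) - ?x powr (1 - s) = (1 - s) * z powr (- s)" by auto
    have "z powr (- s) \<le> ?x powr (- s)" using z(1) x s by (intro powr_mono2') auto
    hence "(s - 1) * z powr (- s) \<le> (s - 1) * ?x powr (- s)" using s by simp
    thus ?thesis using z(2) by (simp add: algebra_simps)
  qed
  have "(\<lambda>n. (s - 1) * (real n + a) powr (- s)) sums ((s - 1) * (\<Sum>n. (real n + a) powr (- s)))"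
    by (intro sums_mult summable_sums summable_shifted_powr a s)
  from sums_le[OF le tel this] show ?thesis .
qed

lemma Re_mellin_of_real:
  assumes a: "0 < a" "a < 1" and w: "w > 0"
  shows "((\<lambda>y. y powr (w - 1) * Re (csc_kernel a y)) has_integral Re (Re_mellin a (of_real w))) {0<..}"
    and "Re_mellin a (of_real w) = of_real (Re (Re_mellin a (of_real w)))"
proof -
  obtain C where C: "\<And>y. y \<ge> 0 \<Longrightarrow> norm (csc_kernel a y) \<le> C * exp (- y)"
    using norm_csc_kernel_le[OF a] by metis
  have "(\<lambda>y. complex_of_real y powr (of_real w - 1) * of_real (Re (csc_kernel a y))) integrable_on {0<..}"
  proof (rule mellin_integrand_integrable)
    show "norm (complex_of_real (Re (csc_kernel a y))) \<le> C * exp (- y)" if "y > 0" for y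
      using order.trans[OF abs_Re_le_cmod C] that by simp
  qed (use w in \<open>auto intro!: continuous_intros continuous_on_csc_kernel a\<close>)
  hence "((\<lambda>y. complex_of_real y powr (of_real w - 1) * of_real (Re (csc_kernel a y)))
      has_integral Re_mellin a (of_real w)) {0<..}"
    unfolding Re_mellin_def mellin_def by (rule integrable_integral)
  hence int: "((\<lambda>y. complex_of_real (y powr (w - 1) * Re (csc_kernel a y))) has_integral Re_mellin a (of_real w)) {0<..}"
    by (rule has_integral_eq[rotated]) (use powr_of_real[of _ "w - 1"] in simp)
  from has_integral_Re[OF this]
  show re: "((\<lambda>y. y powr (w - 1) * Re (csc_kernel a y)) has_integral Re (Re_mellin a (of_real w))) {0<..}"
    by simp
  show "Re_mellin a (of_real w) = of_real (Re (Re_mellin a (of_real w)))"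
    using has_integral_unique[OF int has_integral_of_real[OF re]] .
qed

text \<open>With \<open>cos (2 pi a) \<le> 0\<close> the numerator
  \<open>1 - cos (2 pi a) * cosh (2 pi y)\<close> is positive for all \<open>y\<close>, hence so is
  the integrand.\<close>

lemma Re_mellin_pos:
  assumes a: "0 < a" "a < 1" and c: "cos (2 * pi * a) \<le> 0" and w: "w > 0"
  shows "Re (Re_mellin a (of_real w)) > 0"
proof -
  define f where "f = (\<lambda>y. y powr (w - 1) * Re (csc_kernel a y))"
  have K: "Re (csc_kernel a y) > 0" for y
  proof -
    have ch: "cosh (2 * pi * y) \<ge> 1" by (rule cosh_real_ge_1)
    have "cos (2 * pi * a) * cosh (2 * pi * y) \<le> 0"
      using c ch by (intro mult_nonpos_nonneg) linarith+
    hence "1 - cos (2 * pi * a) * cosh (2 * pi * y) > 0" by linarith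
    moreover have "cosh (2 * pi * y) - cos (2 * pi * a) > 0" using c ch by linarith
    ultimately show ?thesis unfolding Re_csc_kernel by (intro divide_pos_pos mult_pos_pos) simp_all
  qed
  have int: "(f has_integral Re (Re_mellin a (of_real w))) {0<..}"
    unfolding f_def by (rule Re_mellin_of_real(1)[OF a w])
  have cont: "continuous_on {1..2} f"
    unfolding f_def by (intro continuous_intros continuous_on_csc_kernel a) auto
  have pos: "f y > 0" if "y > 0" for y using that K by (simp add: f_def)
  have nn: "f y \<ge> 0" if "y \<in> {0<..}" for y using pos[of y] that by simp
  \<comment> \<open>Strictness comes from a compact interval on which the integrand is continuous
    and positive.\<close>
  have "integral {1..2} f \<noteq> 0"
  proof
    assume "integral {1..2} f = 0"
    moreover have "(1::real) < 2" by simp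
    ultimately have "\<forall>y\<in>{1..2}. f y = 0"
      using integral_eq_0_iff[OF cont _ nn] by simp
    hence "f 1 = 0" by simp
    with pos[of 1] show False by simp
  qed
  moreover have "integral {1..2} f \<ge> 0"
    by (intro integral_nonneg integrable_continuous_interval cont nn) simp
  moreover have "integral {1..2} f \<le> integral {0<..} f"
    by (intro integral_subset_le integrable_continuous_interval cont nn has_integral_integrable[OF int])
      (auto intro: nn)
  ultimately show ?thesis using int by (simp add: has_integral_iff)
qed

text \<open>In the strip formula the sine is at most 1 and each \<open>(s - 1) * T u\<close> is at
  least \<open>u powr (1 - s) \<ge> 1\<close>. The bound is independent of \<open>s\<close> and so
  survives the limit \<open>s\<close> to 1.\<close>

lemma Re_mellin_ge_pi:
  assumes a: "0 < a" "a < 1" and s: "1 < s" "s < 2"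
  shows "Re (Re_mellin a (2 - of_real s)) \<ge> pi"
proof -
  define T where "T = (\<lambda>u. \<Sum>n. (real n + u) powr (- s))"
  define S where "S = sin (pi * s / 2)"
  have S: "S > 0" "S \<le> 1" unfolding S_def using s by (auto intro!: sin_gt_zero)
  have T: "(s - 1) * T u \<ge> 1" if "0 < u" "u < 1" for u
  proof -
    have "1 powr (1 - s) \<le> u powr (1 - s)" using that s by (intro powr_mono2') auto
    thus ?thesis using suminf_shifted_powr_ge[of u s] that s by (simp add: T_def)
  qed
  have "pi \<le> pi / S * 1" using S by (simp add: field_simps)
  also have "\<dots> \<le> pi / S * (((s - 1) * T a + (s - 1) * T (1 - a)) / 2)"
    using T[of a] T[of "1 - a"] a S by (intro mult_left_mono) auto
  also have "\<dots> = (s - 1) * pi / (2 * S) * (T a + T (1 - a))"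
    using S by (simp add: field_simps)
  finally show ?thesis
    unfolding Re_mellin_strip[OF assms] T_def S_def by simp
qed

lemma continuous_Re_mellin:
  assumes a: "0 < a" "a < 1"
  shows "continuous_on {..<2} (\<lambda>s. Re (Re_mellin a (2 - of_real s)))"
proof -
  have "continuous_on {..<2} (\<lambda>s::real. Re_mellin a (2 - of_real s))"
    by (rule continuous_on_compose2[OF holomorphic_on_imp_continuous_on[OF holomorphic_Re_mellin[OF a]]])
      (auto intro!: continuous_intros)
  thus ?thesis by (intro continuous_intros)
qed

text \<open>The strip formula covers only \<open>s > 1\<close>, so the value at 1 is reached by
  continuity from the right.\<close>

lemma Re_mellin_1_ge_pi:
  assumes a: "0 < a" "a < 1"
  shows "Re (Re_mellin a 1) \<ge> pi"
proof -
  let ?f = "\<lambda>s. Re (Re_mellin a (2 - of_real s))"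
  have "isCont ?f 1"
    using continuous_Re_mellin[OF a] by (simp add: continuous_on_eq_continuous_at)
  hence "(?f \<longlongrightarrow> ?f 1) (at_right 1)"
    by (simp add: isCont_def filterlim_at_split)
  moreover have "eventually (\<lambda>s. pi \<le> ?f s) (at_right 1)"
    using eventually_at_right_less[of "1::real"] eventually_at_right_real[of 1 2, simplified]
    by eventually_elim (auto intro!: Re_mellin_ge_pi a)
  ultimately have "pi \<le> ?f 1"
    by (intro tendsto_lowerbound) auto
  thus ?thesis by simp
qed

text \<open>For large exponents the weight \<open>y powr p\<close> concentrates the integral where \<open>Re (csc_kernel a y)\<close> is negative.\<close>

lemma Re_mellin_neg:
  assumes a: "0 < a" "a < 1" and c: "cos (2 * pi * a) > 0"
  obtains n :: nat where "Re (Re_mellin a (2 - of_real (1 - real n))) < 0"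
proof -
  define f where "f = (\<lambda>y. Re (csc_kernel a y))"
  obtain C where C: "C > 0" "\<And>y. y \<ge> 0 \<Longrightarrow> norm (csc_kernel a y) \<le> C * exp (- y)"
    using norm_csc_kernel_le[OF a] by metis
  have fC: "f y \<le> C * exp (- y)" if "y \<ge> 0" for y
    using order.trans[OF complex_Re_le_cmod C(2)[OF that]] by (simp add: f_def)
  \<comment> \<open>From \<open>cosh (2 pi y) > y\<close> it follows that the numerator of the real
    part is negative for all \<open>y \<ge> y1\<close>.\<close>
  define y1 where "y1 = 1 / cos (2 * pi * a)"
  have y1: "y1 > 0" using c by (simp add: y1_def)
  have neg: "f y < 0" if "y \<ge> y1" for y
  proof -
    have "1 + 2 * pi * y \<le> exp (2 * pi * y)" by (rule exp_ge_add_one_self)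
    moreover have "1 * y \<le> pi * y" using that y1 pi_gt3 by (intro mult_right_mono) auto
    moreover have "cosh (2 * pi * y) > exp (2 * pi * y) / 2" by (simp add: cosh_def)
    ultimately have "cosh (2 * pi * y) > y1" using that by linarith
    hence "1 - cos (2 * pi * a) * cosh (2 * pi * y) < 0"
      using c by (simp add: y1_def field_simps)
    moreover have "cosh (2 * pi * y) - cos (2 * pi * a) > 0"
      using cosh_real_ge_1[of "2 * pi * y"] cos_2pi_less_one[OF a] by linarith
    ultimately show ?thesis unfolding f_def Re_csc_kernel
      by (intro divide_neg_pos mult_pos_neg) simp_all
  qed
  have "continuous_on {2*y1..3*y1} f"
    unfolding f_def by (intro continuous_intros continuous_on_csc_kernel a)
  then obtain z where z: "z \<in> {2*y1..3*y1}" "\<And>y. y \<in> {2*y1..3*y1} \<Longrightarrow> f y \<le> f z"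
    using continuous_attains_sup[of "{2*y1..3*y1}" f] y1 by auto
  define m where "m = - f z"
  have m: "m > 0" using neg[of z] z(1) y1 by (simp add: m_def)
  \<comment> \<open>Below \<open>y1\<close> the integral is at most \<open>y1 ^ n * C\<close>,
    whereas the interval from \<open>2 * y1\<close> to \<open>3 * y1\<close>, where
    \<open>f \<le> - m\<close>, contributes at most \<open>- (2 * y1) ^ n * m * y1\<close>. The
    factor \<open>2 ^ n\<close> decides.\<close>
  obtain n where n: "C / (m * y1) < 2 ^ n" using real_arch_pow[of 2] by auto
  define g where "g = (\<lambda>y. y1 ^ n * C * exp (- y) - (if y \<in> {2*y1..3*y1} then (2 * y1) ^ n * m else 0))"
  have I1: "((\<lambda>y. exp (- y)) has_integral (1::real)) {0<..}"
  proof -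
    have "((\<lambda>y. exp (- 1 * y)) has_integral exp (- 1 * 0) / (1::real)) {0..}"
      by (rule has_integral_exp_minus_to_infinity) simp
    hence "((\<lambda>y. exp (- y)) has_integral (1::real)) {0..}" by simp
    thus ?thesis
      by (subst has_integral_spike_set_eq[where T = "{0..}"]) (auto intro: negligible_subset[of "{0}"])
  qed
  have I2: "((\<lambda>y. if y \<in> {2*y1..3*y1} then (2 * y1) ^ n * m else 0) has_integral ((2 * y1) ^ n * m * y1)) {0<..}"
  proof -
    have "{2*y1..3*y1} \<inter> {0<..} = {2*y1..3*y1}" using y1 by auto
    moreover have "((\<lambda>y. (2 * y1) ^ n * m) has_integral ((2 * y1) ^ n * m * y1)) {2*y1..3*y1}"
      using has_integral_const_real[of "(2 * y1) ^ n * m" "2*y1" "3*y1"] y1 by (simp add: mult_ac)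
    ultimately show ?thesis by (subst has_integral_restrict_Int) simp
  qed
  have g: "(g has_integral (y1 ^ n * C * 1 - (2 * y1) ^ n * m * y1)) {0<..}"
    unfolding g_def by (intro has_integral_diff has_integral_mult_right I1 I2)
  have F: "((\<lambda>y. y powr ((1 + real n) - 1) * f y) has_integral Re (Re_mellin a (of_real (1 + real n)))) {0<..}"
    unfolding f_def by (rule Re_mellin_of_real(1)[OF a]) simp
  have "Re (Re_mellin a (of_real (1 + real n))) \<le> y1 ^ n * C * 1 - (2 * y1) ^ n * m * y1"
  proof (rule has_integral_le[OF F g])
    fix y :: real assume "y \<in> {0<..}"
    hence y: "y > 0" by simp
    have p: "y powr ((1 + real n) - 1) = y ^ n" using y by (simp add: powr_realpow)
    consider "y < y1" | "y \<ge> y1" "y \<notin> {2*y1..3*y1}" | "y \<in> {2*y1..3*y1}" by linarith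
    hence "y ^ n * f y \<le> g y"
    proof cases
      case 1
      have "y ^ n * f y \<le> y ^ n * (C * exp (- y))" using y by (intro mult_left_mono fC) auto
      also have "\<dots> \<le> y1 ^ n * (C * exp (- y))" using y 1 C(1) by (intro mult_right_mono power_mono) auto
      finally show ?thesis using 1 y1 by (simp add: g_def)
    next
      case 2
      have "y ^ n * f y \<le> 0" using neg[OF 2(1)] y by (intro mult_nonneg_nonpos) auto
      moreover have "0 \<le> g y" unfolding g_def if_not_P[OF 2(2)] using y1 C(1) by simp
      ultimately show ?thesis by linarith
    next
      case 3
      have "(2 * y1) ^ n * m \<le> y ^ n * m" using 3 y1 m by (intro mult_right_mono power_mono) auto
      also have "\<dots> \<le> y ^ n * (- f y)" using z(2)[OF 3] y by (intro mult_left_mono) (auto simp: m_def)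
      finally have "y ^ n * f y \<le> - ((2 * y1) ^ n * m)" by simp
      also have "\<dots> \<le> y1 ^ n * C * exp (- y) - (2 * y1) ^ n * m" using y1 C(1) by simp
      finally show ?thesis using 3 by (simp add: g_def)
    qed
    thus "y powr ((1 + real n) - 1) * f y \<le> g y" by (simp only: p)
  qed
  also have "\<dots> = y1 ^ n * (C - 2 ^ n * (m * y1))" by (simp add: power_mult_distrib algebra_simps)
  also have "\<dots> < 0" using n m y1 by (intro mult_pos_neg) (auto simp: field_simps)
  finally have "Re (Re_mellin a (of_real (1 + real n))) < 0" .
  moreover have "complex_of_real (1 + real n) = 2 - of_real (1 - real n)" by simp
  ultimately show ?thesis using that by simp
qed

text \<open>The intermediate value theorem between a negative value at some \<open>1 - n\<close> and
  the positive value at 1.\<close>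

lemma Re_mellin_zero:
  assumes a: "0 < a" "a < 1" and c: "cos (2 * pi * a) > 0"
  obtains s where "s < 1" "Re_mellin a (2 - of_real s) = 0"
proof -
  let ?f = "\<lambda>s. Re (Re_mellin a (2 - of_real s))"
  obtain n :: nat where n: "?f (1 - real n) < 0" using Re_mellin_neg[OF a c] by blast
  have one: "?f 1 > 0" using less_le_trans[OF pi_gt_zero Re_mellin_1_ge_pi[OF a]] by simp
  have "\<exists>x\<ge>1 - real n. x \<le> 1 \<and> ?f x = 0"
    by (rule IVT') (use n one in \<open>auto intro!: continuous_on_subset[OF continuous_Re_mellin[OF a]]\<close>)
  then obtain s where s: "s \<le> 1" "?f s = 0" by blast
  with one have "s < 1" by (cases "s = 1") auto
  moreover have "Re_mellin a (of_real (2 - s)) = 0"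
    using Re_mellin_of_real(2)[OF a, of "2 - s"] s by simp
  ultimately show ?thesis using that by simp
qed

section \<open>Holomorphy, derivatives and simple zeros left of the pole\<close>

text \<open>At a zero of the sine only the derivative of the sine survives in the product rule. The
  derivative of \<open>hurwitz_Z\<close> therefore vanishes at such a point if
  \<open>Re_mellin\<close> does.\<close>

lemma hurwitz_Z_has_derivative:
  assumes a: "0 < a" "a < 1" and s: "Re s < 1" and z: "sin (of_real pi * s / 2) = 0"
  shows "(hurwitz_Z a has_field_derivative cos (of_real pi * s / 2) / (s - 1) * Re_mellin a (2 - s)) (at s)"
proof -
  have s1: "s \<noteq> 1" using s by auto
  have "((\<lambda>s. Re_mellin a (2 - s)) has_field_derivative deriv (Re_mellin a) (2 - s) * (0 - 1)) (at s)"
    by (rule DERIV_chain2[of "Re_mellin a"])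
      (use s in \<open>auto intro!: holomorphic_derivI[OF holomorphic_Re_mellin[OF a]] open_halfspace_Re_gt derivative_eq_intros\<close>)
  hence "((\<lambda>s. 2 / (of_real pi * (s - 1)) * Re_mellin a (2 - s)) has_field_derivative
      2 / (of_real pi * (s - 1)) * (deriv (Re_mellin a) (2 - s) * (0 - 1)) +
      - 2 * of_real pi / (of_real pi * (s - 1))\<^sup>2 * Re_mellin a (2 - s)) (at s)"
    using s1 by (intro DERIV_mult') (auto intro!: derivative_eq_intros simp: power2_eq_square)
  moreover have "((\<lambda>s. sin (of_real pi * s / 2)) has_field_derivative
      of_real pi / 2 * cos (of_real pi * s / 2)) (at s)"
    by (auto intro!: derivative_eq_intros)
  ultimately have "((\<lambda>s. sin (of_real pi * s / 2) * (2 / (of_real pi * (s - 1)) * Re_mellin a (2 - s)))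
      has_field_derivative of_real pi / 2 * cos (of_real pi * s / 2) * (2 / (of_real pi * (s - 1)) * Re_mellin a (2 - s))) (at s)"
    using DERIV_mult'[of "\<lambda>s. sin (of_real pi * s / 2)" _ s UNIV] z by fastforce
  moreover have "of_real pi / 2 * cos (of_real pi * s / 2) * (2 / (of_real pi * (s - 1)) * Re_mellin a (2 - s)) =
      cos (of_real pi * s / 2) / (s - 1) * Re_mellin a (2 - s)" by simp
  ultimately have "((\<lambda>s. sin (of_real pi * s / 2) * (2 / (of_real pi * (s - 1)) * Re_mellin a (2 - s)))
      has_field_derivative cos (of_real pi * s / 2) / (s - 1) * Re_mellin a (2 - s)) (at s)"
    by (simp only:)
  thus ?thesis
  proof (rule has_field_derivative_transform_within_open)
    show "open {s. Re s < 1}" by (rule open_halfspace_Re_lt)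
    fix w assume "w \<in> {s. Re s < 1}"
    hence "Re w < 2" "w \<noteq> 1" by auto
    from hurwitz_Z_eq[OF a this]
    show "sin (of_real pi * w / 2) * (2 / (of_real pi * (w - 1)) * Re_mellin a (2 - w)) = hurwitz_Z a w"
      by simp
  qed (use s in simp)
qed

lemma holomorphic_hurwitz_Z:
  assumes a: "0 < a" "a < 1"
  shows "hurwitz_Z a holomorphic_on {s. Re s < 1}"
proof -
  have "(\<lambda>s. 2 * sin (of_real pi * s / 2) / (of_real pi * (s - 1)) * Re_mellin a (2 - s)) holomorphic_on {s. Re s < 1}"
    by (intro holomorphic_intros holomorphic_on_compose_gen[OF _ holomorphic_Re_mellin[OF a], unfolded o_def]) auto
  thus ?thesis
  proof (rule holomorphic_transform)
    fix s assume "s \<in> {s. Re s < 1}"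
    hence "Re s < 2" "s \<noteq> 1" by auto
    thus "2 * sin (of_real pi * s / 2) / (of_real pi * (s - 1)) * Re_mellin a (2 - s) = hurwitz_Z a s"
      by (rule hurwitz_Z_eq[OF a, symmetric])
  qed
qed

text \<open>Near \<open>z\<close> the function is \<open>h w * (w - z)\<close> with
  \<open>h z \<noteq> 0\<close>, and its derivative at \<open>z\<close> is
  \<open>h z\<close>.\<close>

lemma zorder_1_imp_deriv_nonzero:
  assumes f: "f holomorphic_on S" "open S" "connected S" "z \<in> S" "\<exists>w\<in>S. f w \<noteq> 0"
    and z: "zorder f z = 1" and d: "(f has_field_derivative D) (at z)"
  shows "D \<noteq> 0"
proof -
  obtain r where r: "r > 0" "zor_poly f z holomorphic_on cball z r"
    "\<And>w. w \<in> cball z r \<Longrightarrow> f w = zor_poly f z w * (w - z) \<and> zor_poly f z w \<noteq> 0"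
    using zorder_exist_zero[OF f] z by auto
  have "((\<lambda>w. zor_poly f z w * (w - z)) has_field_derivative zor_poly f z z) (at z)"
    using r(1) by (auto intro!: derivative_eq_intros
        holomorphic_derivI[OF holomorphic_on_subset[OF r(2) ball_subset_cball]])
  hence "(f has_field_derivative zor_poly f z z) (at z)"
    by (rule has_field_derivative_transform_within_open[of _ _ _ "ball z r"]) (use r in auto)
  with d have "D = zor_poly f z z" by (rule DERIV_unique)
  with r show ?thesis by simp
qed

subsection \<open>The zeros\<close>

lemma hurwitz_Z_nonzero:
  assumes a: "0 < a" "a < 1" and x: "x > 1"
  shows "hurwitz_Z a (of_real x) \<noteq> 0"
proof -
  have a': "0 < 1 - a" "1 - a < 1" using a by auto
  have "hurwitz_Z a (of_real x) = of_real ((\<Sum>n. (real n + a) powr (- x)) + (\<Sum>n. (real n + (1 - a)) powr (- x)))"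
    using a a' x by (simp add: hurwitz_Z_def hurwitz_zeta_eq_series hurwitz_series_of_real)
  moreover have "(\<Sum>n. (real n + a) powr (- x)) + (\<Sum>n. (real n + (1 - a)) powr (- x)) > 0"
    using suminf_shifted_powr_pos[OF a(1) x] suminf_shifted_powr_pos[OF a'(1) x] by linarith
  ultimately show ?thesis by (simp only: of_real_eq_0_iff)
qed

lemma sin_cos_half_pi_even:
  shows "sin (of_real pi * complex_of_real (- 2 * real n) / 2) = 0"
    and "cos (of_real pi * complex_of_real (- 2 * real n) / 2) \<noteq> 0"
proof -
  have e: "of_real pi * complex_of_real (- 2 * real n) / 2 = of_real (- (real n * pi))" by simp
  show "sin (of_real pi * complex_of_real (- 2 * real n) / 2) = 0"
    unfolding e sin_of_real by simp
  show "cos (of_real pi * complex_of_real (- 2 * real n) / 2) \<noteq> 0"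
    unfolding e cos_of_real by simp
qed

text \<open>For \<open>x < 1\<close> the product formula applies, for \<open>x > 1\<close> the
  series is positive, and \<open>x = 1\<close> is excluded by definition.\<close>

lemma real_zeros_Z_altdef:
  assumes a: "0 < a" "a < 1"
  shows "real_zeros_Z a = {- 2 * real n | n. True} \<union> {x. x < 1 \<and> Re_mellin a (2 - of_real x) = 0}"
proof -
  have "x \<noteq> 1 \<and> hurwitz_Z a (of_real x) = 0 \<longleftrightarrow>
      (\<exists>n. x = - 2 * real n) \<or> (x < 1 \<and> Re_mellin a (2 - of_real x) = 0)" for x
  proof (cases "x < 1")
    case True
    hence eq: "hurwitz_Z a (of_real x) =
        2 * sin (of_real pi * of_real x / 2) / (of_real pi * (of_real x - 1)) * Re_mellin a (2 - of_real x)"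
      by (intro hurwitz_Z_eq a) auto
    have "sin (of_real pi * complex_of_real x / 2) = of_real (sin (pi * x / 2))"
      by (simp add: sin_of_real[symmetric])
    hence "sin (of_real pi * complex_of_real x / 2) = 0 \<longleftrightarrow> sin (pi * x / 2) = 0"
      by (simp only: of_real_eq_0_iff)
    also have "\<dots> \<longleftrightarrow> (\<exists>n. x = - 2 * real n)"
    proof
      assume "sin (pi * x / 2) = 0"
      then obtain i :: int where "pi * x / 2 = of_int i * pi" by (auto simp: sin_zero_iff_int2)
      hence i: "x = 2 * of_int i" by simp
      \<comment> \<open>Here \<open>x < 1\<close> discards the positive even zeros of the
        sine.\<close>
      with True have "i \<le> 0" by linarith
      hence "x = - 2 * real (nat (- i))" using i by simp
      thus "\<exists>n. x = - 2 * real n" ..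
    next
      assume "\<exists>n. x = - 2 * real n"
      then obtain n where "x = - 2 * real n" ..
      hence "pi * x / 2 = - (real n * pi)" by simp
      thus "sin (pi * x / 2) = 0" by (simp only: sin_minus sin_npi minus_zero)
    qed
    finally show ?thesis using True unfolding eq by auto
  next
    case False
    hence "x > 1" if "x \<noteq> 1" using that by simp
    thus ?thesis using False hurwitz_Z_nonzero[OF a, of x] by auto
  qed
  thus ?thesis by (auto simp: real_zeros_Z_def)
qed

text \<open>A zero with nonvanishing derivative is simple; here the derivative is a nonzero multiple
  of the value of \<open>Re_mellin\<close>.\<close>

lemma zorder_hurwitz_Z_even:
  assumes a: "0 < a" "a < 1" and nz: "Re_mellin a (2 - of_real (- 2 * real n)) \<noteq> 0"
  shows "zorder (hurwitz_Z a) (of_real (- 2 * real n)) = 1"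
proof -
  let ?z = "complex_of_real (- 2 * real n)"
  have z1: "Re ?z < 1" by simp
  have "(hurwitz_Z a has_field_derivative
      cos (of_real pi * ?z / 2) / (?z - 1) * Re_mellin a (2 - ?z)) (at ?z)"
    using hurwitz_Z_has_derivative[OF a z1 sin_cos_half_pi_even(1)] .
  hence d: "deriv (hurwitz_Z a) ?z = cos (of_real pi * ?z / 2) / (?z - 1) * Re_mellin a (2 - ?z)"
    by (rule DERIV_imp_deriv)
  have "?z - 1 \<noteq> 0" using z1 by (metis eq_iff_diff_eq_0 less_irrefl one_complex.sel(1))
  hence "deriv (hurwitz_Z a) ?z \<noteq> 0"
    unfolding d mult_eq_0_iff divide_eq_0_iff using nz sin_cos_half_pi_even(2)[of n] by blast
  moreover have "- 2 * real n \<in> real_zeros_Z a"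
    unfolding real_zeros_Z_altdef[OF a] by blast
  hence "hurwitz_Z a ?z = 0" unfolding real_zeros_Z_def by blast
  ultimately show ?thesis
    by (intro zorder_zero_eqI[OF holomorphic_hurwitz_Z[OF a] open_halfspace_Re_lt]) auto
qed

text \<open>The cosine decreases on the interval from 0 to \<open>pi\<close>, which contains
  \<open>2 * pi * a\<close>.\<close>

lemma cos_2pi_nonpos_iff:
  fixes a :: real
  assumes "0 < a" "a \<le> 1/2"
  shows "cos (2 * pi * a) \<le> 0 \<longleftrightarrow> 1/4 \<le> a"
proof -
  have "cos (2 * pi * a) \<le> cos (pi / 2) \<longleftrightarrow> pi / 2 \<le> 2 * pi * a"
    using assms by (intro cos_mono_le_eq) auto
  also have "\<dots> \<longleftrightarrow> 1/4 \<le> a" by (simp add: field_simps)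
  finally show ?thesis by simp
qed

theorem theorem1p3:
  fixes a :: real
  assumes "0 < a" and "a \<le> 1/2"
  shows "(real_zeros_Z a = {- 2 * real n | n::nat. True} \<and>
          (\<forall>n::nat. zorder (hurwitz_Z a) (complex_of_real (- 2 * real n)) = 1))
         \<longleftrightarrow> (1/4 \<le> a \<and> a \<le> 1/2)"
proof
  have a: "0 < a" "a < 1" using assms by auto
  {
    assume "1/4 \<le> a \<and> a \<le> 1/2"
    hence c: "cos (2 * pi * a) \<le> 0" using cos_2pi_nonpos_iff[OF assms] by simp
    have nz: "Re_mellin a (2 - of_real x) \<noteq> 0" if "x < 1" for x
      using Re_mellin_pos[OF a c, of "2 - x"] that by auto
    show "real_zeros_Z a = {- 2 * real n | n::nat. True} \<and>
          (\<forall>n::nat. zorder (hurwitz_Z a) (complex_of_real (- 2 * real n)) = 1)"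
    proof (intro conjI allI)
      show "real_zeros_Z a = {- 2 * real n | n::nat. True}"
        unfolding real_zeros_Z_altdef[OF a] using nz by blast
      show "zorder (hurwitz_Z a) (complex_of_real (- 2 * real n)) = 1" for n
        by (intro zorder_hurwitz_Z_even a nz) simp
    qed
  next
    assume *: "real_zeros_Z a = {- 2 * real n | n::nat. True} \<and>
          (\<forall>n::nat. zorder (hurwitz_Z a) (complex_of_real (- 2 * real n)) = 1)"
    have "1/4 \<le> a"
    proof (rule ccontr)
      assume "\<not> 1/4 \<le> a"
      hence c: "cos (2 * pi * a) > 0" using cos_2pi_nonpos_iff[OF assms] by simp
      obtain s where s: "s < 1" "Re_mellin a (2 - of_real s) = 0" using Re_mellin_zero[OF a c] .
      hence "s \<in> real_zeros_Z a" by (simp add: real_zeros_Z_altdef[OF a])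
      with * obtain n where n: "s = - 2 * real n" by auto
      let ?z = "complex_of_real (- 2 * real n)"
      have z1: "Re ?z < 1" by simp
      \<comment> \<open>The odd point \<open>- 1\<close> witnesses that \<open>hurwitz_Z a\<close>
        is not identically zero, as the factorisation at a zero demands.\<close>
      have "- 1 \<notin> real_zeros_Z a"
      proof
        assume "- 1 \<in> real_zeros_Z a"
        with * obtain k where "- 1 = - 2 * real k" by auto
        hence "real (2 * k) = real 1" by simp
        hence "2 * k = 1" by (simp only: of_nat_eq_iff)
        thus False by presburger
      qed
      hence ex: "\<exists>w\<in>{w. Re w < 1}. hurwitz_Z a w \<noteq> 0"
        by (intro bexI[of _ "of_real (- 1)"]) (auto simp: real_zeros_Z_def)
      \<comment> \<open>The zero of \<open>Re_mellin\<close> lies at a trivial zero, where the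
        derivative of \<open>hurwitz_Z\<close> is a multiple of it. Simplicity forces this
        derivative to be nonzero, a contradiction.\<close>
      have "cos (of_real pi * ?z / 2) / (?z - 1) * Re_mellin a (2 - ?z) \<noteq> 0"
      proof (rule zorder_1_imp_deriv_nonzero[OF holomorphic_hurwitz_Z[OF a] open_halfspace_Re_lt _ _ ex])
        show "connected {w. Re w < 1}" by (intro convex_connected convex_halfspace_Re_lt)
        show "(hurwitz_Z a has_field_derivative
            cos (of_real pi * ?z / 2) / (?z - 1) * Re_mellin a (2 - ?z)) (at ?z)"
          using hurwitz_Z_has_derivative[OF a z1 sin_cos_half_pi_even(1)] .
      qed (use * z1 in auto)
      with s(2) n show False by simp
    qed
    thus "1/4 \<le> a \<and> a \<le> 1/2" using assms by simp
  }
qed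

end
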